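(* Let $k,\ell$ be non-negative integers and let $\mu_1,\mu_2,\xi_1,\xi_2$ be four parameters (indeterminates). Then \begin{align*} &\sum_{\substack{a_1+a_2=k\\ b_1+b_2=\ell}} \mu_1^{a_1}\mu_2^{a_2}\xi_1^{b_1}\xi_2^{b_2}\,\zeta(a_1+b_1+2)\,\zeta(a_2+b_2+2)\\ =&\sum_{\sigma\in\mathfrak S_2}\Bigg[\sum_{\substack{a_1+a_2=k\\ b_1+b_2=\ell}} \mu_{\sigma(1)}^{a_1}\mu_{\sigma(2)}^{a_2}\xi_{\sigma(1)}^{b_1}\xi_{\sigma(2)}^{b_2}\sum_{\substack{|\boldsymbol\alpha|=a_1+b_1+1\\ |\boldsymbol\beta|=a_2+b_2+1}}\zeta(\alpha_0,\alpha_1,\ldots,\alpha_{a_1}+1,\ \beta_0,\beta_1,\ldots,\beta_{a_2}+1)\\ &+\sum_{\substack{a_1+a_2+a_3=k\\ b_1+b_2+b_3=\ell}} \mu_{\sigma(1)}^{a_1}\xi_{\sigma(1)}^{b_1}(\mu_{\sigma(1)}+\mu_{\sigma(2)})^{a_2}(\xi_{\sigma(1)}+\xi_{\sigma(2)})^{b_2}\left(\mu_{\sigma(1)}^{a_3}\xi_{\sigma(1)}^{b_3}+\mu_{\sigma(2)}^{a_3}\xi_{\sigma(2)}^{b_3}\right)\\ &\qquad\times\sum_{\substack{|\boldsymbol\alpha|=a_1+b_1+1\\ |\boldsymbol\beta|=a_2+b_2+1\\ |\boldsymbol\gamma|=a_3+b_3+1}}\zeta(\alpha_0,\ldots,\alpha_{a_1},\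 \beta_0,\beta_1,\ldots,\beta_{a_2}+\gamma_0,\ \gamma_1,\ldots,\gamma_{a_3}+1)\Bigg]. \end{align*} Here the $a_i$ and $b_i$ run over non-negative integers with the indicated sums, and the inner sums run over all tuples of positive integers $\boldsymbol\alpha=(\alpha_0,\ldots,\alpha_{a_1})$, $\boldsymbol\beta=(\beta_0,\ldots,\beta_{a_2})$, $\boldsymbol\gamma=(\gamma_0,\ldots,\gamma_{a_3})$ with the indicated values of $|\boldsymbol\alpha|=\alpha_0+\cdots+\alpha_{a_1}$, $|\boldsymbol\beta|=\beta_0+\cdots+\beta_{a_2}$, $|\boldsymbol\gamma|=\gamma_0+\cdots+\gamma_{a_3}$.
   Context: For positive integers $\alpha_1,\ldots,\alpha_n$ with $\alpha_n\ge 2$, the multiple zeta value is the real number $$\zeta(\alpha_1,\ldots,\alpha_n)=\sum_{0<\ell_1<\ell_2<\cdots<\ell_n}\frac{1}{\ell_1^{\alpha_1}\ell_2^{\alpha_2}\cdots\ell_n^{\alpha_n}},$$ the sum being over positive integers $\ell_1<\cdots<\ell_n$. $\mathfrak S_n$ is the symmetric group on $\{1,\ldots,n\}$. Conventions on indices: commas separate the entries of the index, and sums such as $\beta_{a_2}+\gamma_0$ or $\alpha_{a_1}+1$ are single entries. Thus $(\alpha_0,\alpha_1,\ldots,\alpha_{a_1}+1)$ has $a_1+1$ entries, with $1$ added to the last (it is $(\alpha_0+1)$ if $a_1=0$). The block $(\beta_0,\ldots,\beta_{a_2}+\gamma_0,\gamma_1,\ldots,\gamma_{a_3}+1)$ has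 $a_2+a_3+1$ entries: it is obtained by merging the last entry of $(\beta_0,\ldots,\beta_{a_2})$ and the first entry of $(\gamma_0,\ldots,\gamma_{a_3})$ into their sum, and then adding $1$ to the last entry (so if $a_3=0$ its last entry is $\beta_{a_2}+\gamma_0+1$). Zeroth powers equal $1$. *)

theory Defs
  imports "HOL-Analysis.Analysis" "HOL-Combinatorics.Permutations"
begin

definition increasing_tuples :: "nat \<Rightarrow> nat list set" where
  "increasing_tuples n =
     {ls. length ls = n \<and> (\<forall>l\<in>set ls. 0 < l) \<and> sorted_wrt (<) ls}"

text \<open>The family is absolutely summable whenever all entries of \<open>as\<close> are positive and the
  last one is at least 2; only such indices occur in the statement.  Otherwise the value is
  not meaningful (\<open>infsum\<close> of a non-summable family is 0).\<close>

definition mzv :: "nat list \<Rightarrow> real" where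
  "mzv as = (\<Sum>\<^sub>\<infinity>ls\<in>increasing_tuples (length as).
               1 / (\<Prod>i<length as. real (ls ! i) ^ (as ! i)))"

definition compositions :: "nat \<Rightarrow> nat \<Rightarrow> nat list set" where
  "compositions m w = {as. length as = m \<and> (\<forall>a\<in>set as. 0 < a) \<and> sum_list as = w}"

lemma finite_compositions: "finite (compositions m w)"
proof (rule finite_subset)
  show "compositions m w \<subseteq> {as. set as \<subseteq> {..w} \<and> length as = m}"
    by (auto simp: compositions_def member_le_sum_list)
qed (simp add: finite_lists_length_eq)

definition inc_last :: "nat list \<Rightarrow> nat list" where
  "inc_last as = butlast as @ [last as + 1]"

definition merge_lists :: "nat list \<Rightarrow> nat list \<Rightarrow> nat list" where
  "merge_lists bs cs = butlast bs @ [last bs + hd cs] @ tl cs"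

end

theory Submission
  imports Defs
    "HOL-Computational_Algebra.Formal_Power_Series"
    "HOL-Complex_Analysis.Cauchy_Integral_Formula"
begin

text \<open>
  The identity is a shuffle product in disguise.  A multiple zeta value is an iterated integral
  from 0 to 1 of the forms \<open>dt/(1 - t)\<close> and \<open>dt/t\<close>, and the sum of all \<open>\<zeta>(\<alpha>\<^sub>0, \<dots>, \<alpha>\<^sub>a + 1)\<close> with
  \<open>|\<alpha>| = a + b + 1\<close> is the integral over \<open>0 < t < u < 1\<close> of \<open>dt/(1 - t) du/u\<close> against all words with
  \<open>a\<close> letters \<open>dt/(1 - t)\<close> and \<open>b\<close> letters \<open>dt/t\<close> placed between \<open>t\<close> and \<open>u\<close>.  By the sum formula it
  equals \<open>\<zeta>(a + b + 2)\<close>.  Give each letter of the first kind the weight \<open>\<mu>\<^sub>i\<close> and each letter of the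
  second kind the weight \<open>\<xi>\<^sub>i\<close>.  A product of two such integrals runs over \<open>t\<^sub>1 < u\<^sub>1\<close> and
  \<open>t\<^sub>2 < u\<^sub>2\<close>, and the relative order of these four points cuts the domain into six pieces.  In two of
  them the intervals are disjoint; they give the first sum on the right.  In the other four the
  intervals overlap, the weights add up on the overlap, and they give the second sum.

  No integral is needed to make this precise.  Polylogarithms are formal power series, the two letters
  act on them by \<open>int0\<close> and \<open>int1\<close>, and a zeta value is the sum of the coefficients of its
  polylogarithm (\<open>polylog_sums_mzv\<close>).  Two further formal variables count the letters of either kind, so
  that all weighted words together form the operator \<open>flow\<close>, which solves a first order linear
  equation for the Euler operator \<open>t d/dt\<close>.  Solutions without constant term are unique
  (\<open>euler_equation_unique\<close>), so the decomposition into six pieces, \<open>product_flow\<close>, follows by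
  differentiating both sides.  Cutting words into exponents (\<open>sum_run_index\<close>) turns its coefficients into the
  sums over \<open>\<alpha>\<close>, \<open>\<beta>\<close>, \<open>\<gamma>\<close>.

  The sum formula \<open>sum_formula\<close> is proved by a connected sum.  For \<open>0 \<le> x < 1\<close> the generating function over
  \<open>b\<close> of the left hand side is a nested sum over \<open>n\<^sub>0 < \<dots> < n\<^sub>a\<close>.  It is joined to a second sum over \<open>m\<close>
  by the factor \<open>connector\<close>, whose telescoping property moves the summation indices one after
  the other from the first sum to the second.  Comparing coefficients of \<open>x\<^sup>b\<close> yields the formula.

  The parameters lie in an algebra that carries no topology, so the coefficients are summed after
  applying an arbitrary real linear functional (\<open>weak_sums\<close>); these functionals separate points.
\<close>

unbundle no vec_syntax
unbundle fps_syntax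

section \<open>Polylogarithms as formal power series\<close>

definition euler_op :: "'a::comm_ring_1 fps \<Rightarrow> 'a fps" where
  "euler_op f = fps_X * fps_deriv f"

definition geom_tail :: "'a::comm_ring_1 fps" where
  "geom_tail = Abs_fps (\<lambda>n. if n = 0 then 0 else 1)"

text \<open>
  These are \<open>f \<mapsto> \<integral> f dt/t\<close> and \<open>f \<mapsto> \<integral> f dt/(1 - t)\<close>, both taken from 0.  Division by zero returns
  zero, so the constant term of the result always vanishes; accordingly \<open>int0\<close> is a genuine antiderivative only
  when \<open>f\<close> has no constant term.
\<close>

definition int0 :: "'a::{real_algebra_1, comm_ring_1} fps \<Rightarrow> 'a fps" where
  "int0 f = Abs_fps (\<lambda>n. (1 / real n) *\<^sub>R (f $ n))"

definition int1 :: "'a::{real_algebra_1, comm_ring_1} fps \<Rightarrow> 'a fps" where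
  "int1 f = int0 (geom_tail * f)"

lemma euler_op_nth [simp]: "euler_op f $ n = of_nat n * f $ n"
  by (cases n) (auto simp: euler_op_def fps_deriv_nth)

lemma int0_nth [simp]: "int0 f $ n = (1 / real n) *\<^sub>R (f $ n)"
  by (simp add: int0_def)

lemma geom_tail_mult_nth: "(geom_tail * f) $ n = (\<Sum>m<n. f $ m)"
proof -
  have "(f * geom_tail) $ n = (\<Sum>m=0..n. if m < n then f $ m else 0)"
    unfolding fps_mult_nth by (intro sum.cong) (auto simp: geom_tail_def)
  also have "\<dots> = (\<Sum>m<n. f $ m)"
    by (intro sum.mono_neutral_cong_right) auto
  finally show ?thesis by (simp add: mult.commute)
qed

lemma int1_nth [simp]: "int1 f $ n = (1 / real n) *\<^sub>R (\<Sum>m<n. f $ m)"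
  by (simp add: int1_def geom_tail_mult_nth)

lemma euler_op_add [simp]: "euler_op (f + g) = euler_op f + euler_op g"
  by (simp add: euler_op_def algebra_simps)

lemma euler_op_sum [simp]: "euler_op (sum f A) = (\<Sum>i\<in>A. euler_op (f i))"
  by (induction A rule: infinite_finite_induct) (auto simp: euler_op_def algebra_simps)

lemma euler_op_mult: "euler_op (f * g) = euler_op f * g + f * euler_op g"
  by (simp add: euler_op_def algebra_simps)

lemma euler_op_const_mult: "euler_op (fps_const c * f) = fps_const c * euler_op f"
  by (simp add: euler_op_def algebra_simps)

lemma euler_op_int0:
  assumes "f $ 0 = 0" shows "euler_op (int0 f) = f"
proof (rule fps_ext)
  fix n show "euler_op (int0 f) $ n = f $ n"
  proof (cases "n = 0")
    case False
    have "euler_op (int0 f) $ n = real n *\<^sub>R (1 / real n) *\<^sub>R (f $ n)"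
      by (simp add: scaleR_conv_of_real)
    with False show ?thesis by simp
  qed (use assms in simp)
qed

lemma euler_op_int1: "euler_op (int1 f) = geom_tail * f"
  unfolding int1_def by (rule euler_op_int0) (simp add: geom_tail_def)

lemma euler_op_eq_0:
  fixes f :: "'a::{real_algebra_1, comm_ring_1} fps"
  assumes "euler_op f = 0" "f $ 0 = 0" shows "f = 0"
proof (rule fps_ext)
  fix n show "f $ n = 0 $ n"
  proof (cases "n = 0")
    case False
    have "of_nat n * f $ n = 0" using assms(1) by (metis euler_op_nth fps_zero_nth)
    hence "real n *\<^sub>R (f $ n) = 0" by (simp add: scaleR_conv_of_real)
    with False show ?thesis by simp
  qed (use assms in auto)
qed

lemma int0_add: "int0 (f + g) = int0 f + int0 g"
  and int0_sum: "int0 (sum F A) = (\<Sum>i\<in>A. int0 (F i))"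
  and int0_const_mult: "int0 (fps_const c * f) = fps_const c * int0 f"
  by (auto intro!: fps_ext simp: scaleR_add_right fps_sum_nth scaleR_sum_right)

lemma int1_add: "int1 (f + g) = int1 f + int1 g"
  and int1_sum: "int1 (sum F A) = (\<Sum>i\<in>A. int1 (F i))"
  and int1_const_mult: "int1 (fps_const c * f) = fps_const c * int1 f"
  by (simp_all add: int1_def int0_add int0_sum sum_distrib_left distrib_left
        mult.left_commute[of geom_tail "fps_const c"] int0_const_mult)

text \<open>
  The sum over all words in \<open>a\<close> letters \<open>int1\<close> and \<open>b\<close> letters \<open>int0\<close>, applied to \<open>f\<close>; the recursion splits
  off the letter applied last.
\<close>

fun word_sum :: "nat \<Rightarrow> nat \<Rightarrow> 'a::{real_algebra_1, comm_ring_1} fps \<Rightarrow> 'a fps" where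
  "word_sum 0 0 f = f"
| "word_sum (Suc a) 0 f = int1 (word_sum a 0 f)"
| "word_sum 0 (Suc b) f = int0 (word_sum 0 b f)"
| "word_sum (Suc a) (Suc b) f = int1 (word_sum a (Suc b) f) + int0 (word_sum (Suc a) b f)"

lemma word_sum_const_mult: "word_sum a b (fps_const c * f) = fps_const c * word_sum a b f"
  by (induction a b f rule: word_sum.induct)
     (simp_all add: int0_const_mult int1_const_mult distrib_left)

lemma word_sum_sum: "word_sum a b (sum F A) = (\<Sum>i\<in>A. word_sum a b (F i))"
proof -
  have "word_sum a b f = (\<Sum>i\<in>A. word_sum a b (F i))" if "f = sum F A" for f
    using that by (induction a b f rule: word_sum.induct)
     (simp_all add: int0_sum int1_sum sum.distrib)
  thus ?thesis by blast
qed

lemma word_sum_nth_0: "f $ 0 = 0 \<Longrightarrow> word_sum a b f $ 0 = 0"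
  by (induction a b f rule: word_sum.induct) auto

text \<open>
  The Euler operator removes the last letter, which is what makes the generating series of
  all words satisfy a linear differential equation.
\<close>

lemma euler_op_word_sum:
  assumes "f $ 0 = 0"
  shows "euler_op (word_sum a b f) =
           (if a = 0 \<and> b = 0 then euler_op f else
            (if a = 0 then 0 else geom_tail * word_sum (a - 1) b f) +
            (if b = 0 then 0 else word_sum a (b - 1) f))"
  using assms by (cases "(a, b, f)" rule: word_sum.cases) (auto simp: euler_op_int1 euler_op_int0 word_sum_nth_0)

section \<open>The differential equation of the generating series\<close>

text \<open>
  The outer variable marks the number of letters \<open>int1\<close>, the middle one the number of letters
  \<open>int0\<close>, and the inner one is the argument \<open>t\<close> of the polylogarithms.  Multiplication of graded series
  then performs the convolutions over \<open>a\<^sub>1 + a\<^sub>2 = k\<close> and \<open>b\<^sub>1 + b\<^sub>2 = l\<close> automatically.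
\<close>

type_synonym 'a graded = "'a fps fps fps"

definition graded_map :: "('a fps \<Rightarrow> 'a fps) \<Rightarrow> 'a graded \<Rightarrow> 'a graded" where
  "graded_map F h = Abs_fps (\<lambda>k. Abs_fps (\<lambda>l. F (h $ k $ l)))"

lemma graded_map_nth [simp]: "graded_map F h $ k $ l = F (h $ k $ l)"
  by (simp add: graded_map_def)

lemma graded_ext: "(\<And>k l. F $ k $ l = G $ k $ l) \<Longrightarrow> F = G" for F G :: "'a graded"
  by (rule fps_ext, rule fps_ext) simp

lemma graded_mult_nth:
  fixes F G :: "'a::comm_ring_1 graded"
  shows "(F * G) $ k $ l = (\<Sum>i=0..k. \<Sum>j=0..l. F $ i $ j * G $ (k - i) $ (l - j))"
  by (simp add: fps_mult_nth fps_sum_nth)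

abbreviation \<theta> :: "'a::comm_ring_1 graded \<Rightarrow> 'a graded" where "\<theta> \<equiv> graded_map euler_op"

abbreviation embed :: "'a::comm_ring_1 fps \<Rightarrow> 'a graded" where "embed f \<equiv> fps_const (fps_const f)"

lemma theta_add: "\<theta> (F + G) = \<theta> F + \<theta> G"
  by (rule graded_ext) simp

lemma theta_mult: "\<theta> (F * G) = \<theta> F * G + F * \<theta> G"
  by (rule graded_ext) (simp add: graded_mult_nth euler_op_mult sum.distrib)

definition no_const :: "'a::comm_ring_1 graded \<Rightarrow> bool" where
  "no_const F \<longleftrightarrow> (\<forall>k l. F $ k $ l $ 0 = 0)"

lemma no_const_add: "no_const F \<Longrightarrow> no_const G \<Longrightarrow> no_const (F + G)"
  and no_const_mult: "no_const F \<Longrightarrow> no_const (F * G)"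
  and no_const_int0: "no_const (graded_map int0 H)"
  and no_const_int1: "no_const (graded_map int1 H)"
  by (simp_all add: no_const_def graded_mult_nth fps_sum_nth)

lemma theta_int0: "no_const F \<Longrightarrow> \<theta> (graded_map int0 F) = F"
  by (rule graded_ext) (simp add: no_const_def euler_op_int0)

lemma theta_int1: "\<theta> (graded_map int1 F) = embed geom_tail * F"
  by (rule graded_ext) (simp add: euler_op_int1)

text \<open>
  The coefficient of the equation: a letter \<open>int1\<close> costs \<open>m\<close> and one step in the outer degree, a letter
  \<open>int0\<close> costs \<open>x\<close> and one step in the middle degree.  It is additive in the
  parameters; this is why \<open>\<mu>\<^sub>1 + \<mu>\<^sub>2\<close> and \<open>\<xi>\<^sub>1 + \<xi>\<^sub>2\<close> appear where two words overlap.
\<close>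

definition potential :: "'a::comm_ring_1 \<Rightarrow> 'a \<Rightarrow> 'a graded" where
  "potential m x = embed (fps_const m * geom_tail) * fps_X + embed (fps_const x) * fps_const fps_X"

lemma potential_add: "potential m x + potential m' x' = potential (m + m') (x + x')"
  by (simp add: potential_def algebra_simps flip: fps_const_add)

lemma potential_mult_nth:
  "(potential m x * F) $ k $ l =
     (if k = 0 then 0 else fps_const m * geom_tail * F $ (k - 1) $ l) +
     (if l = 0 then 0 else fps_const x * F $ k $ (l - 1))"
proof -
  have "potential m x * F = embed (fps_const m * geom_tail) * (fps_X * F) + embed (fps_const x) * (fps_const fps_X * F)"
    by (simp only: potential_def distrib_right mult.assoc)
  thus ?thesis by simp
qed

text \<open>
  The potential raises the total degree \<open>k + l\<close>, so the difference of two solutions is killed degree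
  by degree: in each degree it has Euler derivative zero and no constant term.
\<close>

lemma euler_equation_unique:
  fixes F G :: "'a::{real_algebra_1, comm_ring_1} graded"
  assumes "\<theta> F = potential m x * F + R" "\<theta> G = potential m x * G + R"
    and "no_const F" "no_const G"
  shows "F = G"
proof (rule graded_ext)
  fix k l show "F $ k $ l = G $ k $ l"
  proof (induction "k + l" arbitrary: k l rule: less_induct)
    case less
    have "\<theta> F $ k $ l - \<theta> G $ k $ l = (potential m x * F) $ k $ l - (potential m x * G) $ k $ l"
      by (simp only: assms fps_add_nth) simp
    also have "\<dots> = 0"
      using less by (auto simp: potential_mult_nth)
    finally have "euler_op (F $ k $ l - G $ k $ l) = 0"
      by (simp add: euler_op_def algebra_simps)
    moreover have "(F $ k $ l - G $ k $ l) $ 0 = 0" using assms(3,4) by (simp add: no_const_def)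
    ultimately have "F $ k $ l - G $ k $ l = 0" by (rule euler_op_eq_0)
    thus ?case by simp
  qed
qed

text \<open>
  All weighted words applied to \<open>h\<close>: an ordered exponential in which \<open>i\<close> and \<open>j\<close> count the
  letters of the two kinds.
\<close>

definition flow :: "'a::{real_algebra_1, comm_ring_1} \<Rightarrow> 'a \<Rightarrow> 'a graded \<Rightarrow> 'a graded" where
  "flow m x h = Abs_fps (\<lambda>k. Abs_fps (\<lambda>l.
     \<Sum>i\<le>k. \<Sum>j\<le>l. fps_const (m ^ i * x ^ j) * word_sum i j (h $ (k - i) $ (l - j))))"

lemma flow_nth [simp]: "flow m x h $ k $ l =
   (\<Sum>i\<le>k. \<Sum>j\<le>l. fps_const (m ^ i * x ^ j) * word_sum i j (h $ (k - i) $ (l - j)))"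
  by (simp add: flow_def)

lemma no_const_flow: "no_const h \<Longrightarrow> no_const (flow m x h)"
  by (simp add: no_const_def fps_sum_nth word_sum_nth_0)

lemma sum_atMost_shift:
  fixes f :: "nat \<Rightarrow> 'b::comm_monoid_add"
  shows "(\<Sum>i\<le>k. if i = 0 then 0 else f i) = (if k = 0 then 0 else \<Sum>i\<le>k - 1. f (Suc i))"
  by (cases k) (simp_all add: sum.atMost_Suc_shift del: sum.atMost_Suc)

text \<open>
  Removing the last letter of every nonempty word leaves all words again, multiplied by the potential;
  only the empty word contributes \<open>\<theta> h\<close>.
\<close>

lemma theta_flow:
  assumes "no_const h"
  shows "\<theta> (flow m x h) = potential m x * flow m x h + \<theta> h"
proof (rule graded_ext)
  fix k l
  let ?h = "\<lambda>i j. h $ (k - i) $ (l - j)"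
  let ?c = "\<lambda>i j. fps_const (m ^ i * x ^ j)"
  have 0: "h $ i $ j $ 0 = 0" for i j using assms by (simp add: no_const_def)
  have "\<theta> (flow m x h) $ k $ l = (\<Sum>i\<le>k. \<Sum>j\<le>l. ?c i j * euler_op (word_sum i j (?h i j)))"
    by (simp add: euler_op_const_mult)
  also have "\<dots> = (\<Sum>i\<le>k. \<Sum>j\<le>l. (if i = 0 then if j = 0 then euler_op (h $ k $ l) else 0 else 0)
        + (if i = 0 then 0 else ?c i j * geom_tail * word_sum (i - 1) j (?h i j))
        + (if j = 0 then 0 else ?c i j * word_sum i (j - 1) (?h i j)))"
    by (intro sum.cong refl) (simp add: euler_op_word_sum[OF 0] distrib_left mult.assoc)
  also have "\<dots> = (\<Sum>i\<le>k. \<Sum>j\<le>l. if i = 0 then if j = 0 then euler_op (h $ k $ l) else 0 else 0)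
       + (\<Sum>i\<le>k. \<Sum>j\<le>l. if i = 0 then 0 else ?c i j * geom_tail * word_sum (i - 1) j (?h i j))
       + (\<Sum>i\<le>k. \<Sum>j\<le>l. if j = 0 then 0 else ?c i j * word_sum i (j - 1) (?h i j))"
    by (simp only: sum.distrib)
  also have "(\<Sum>i\<le>k. \<Sum>j\<le>l. if i = 0 then if j = 0 then euler_op (h $ k $ l) else 0 else 0) = \<theta> h $ k $ l"
  proof -
    have "(\<Sum>i\<le>k. \<Sum>j\<le>l. if i = 0 then if j = 0 then euler_op (h $ k $ l) else 0 else 0)
        = (\<Sum>i\<le>k. if i = 0 then (\<Sum>j\<le>l. if j = 0 then euler_op (h $ k $ l) else 0) else 0)"
      by (intro sum.cong) auto
    thus ?thesis by simp
  qed
  also have "(\<Sum>i\<le>k. \<Sum>j\<le>l. if i = 0 then 0 else ?c i j * geom_tail * word_sum (i - 1) j (?h i j))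
      = (if k = 0 then 0 else fps_const m * geom_tail * flow m x h $ (k - 1) $ l)"
  proof -
    have "(\<Sum>i\<le>k. \<Sum>j\<le>l. if i = 0 then 0 else ?c i j * geom_tail * word_sum (i - 1) j (?h i j))
        = (\<Sum>i\<le>k. if i = 0 then 0 else \<Sum>j\<le>l. ?c i j * geom_tail * word_sum (i - 1) j (?h i j))"
      by (intro sum.cong) auto
    thus ?thesis unfolding sum_atMost_shift
      by (auto simp: sum_distrib_left mult_ac simp flip: fps_const_mult intro!: sum.cong)
  qed
  also have "(\<Sum>i\<le>k. \<Sum>j\<le>l. if j = 0 then 0 else ?c i j * word_sum i (j - 1) (?h i j))
      = (if l = 0 then 0 else fps_const x * flow m x h $ k $ (l - 1))"
    unfolding sum_atMost_shift
      by (auto simp: sum_distrib_left mult_ac simp flip: fps_const_mult intro!: sum.cong)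
  finally show "\<theta> (flow m x h) $ k $ l = (potential m x * flow m x h + \<theta> h) $ k $ l"
    by (simp add: potential_mult_nth add_ac del: flow_nth)
qed

lemma eq_flowI:
  assumes "no_const F" "no_const h" "\<theta> F = potential m x * F + \<theta> h"
  shows "F = flow m x h"
  using euler_equation_unique[OF assms(3) theta_flow[OF assms(2)] assms(1) no_const_flow[OF assms(2)]] .

lemma eq_int0I:
  assumes "no_const F" "no_const R" "\<theta> F = R"
  shows "F = graded_map int0 R"
proof (rule euler_equation_unique[where m = 0 and x = 0])
  show "\<theta> F = potential 0 0 * F + R" using assms by (simp add: potential_def)
  show "\<theta> (graded_map int0 R) = potential 0 0 * graded_map int0 R + R"
    using assms by (simp add: potential_def theta_int0)
qed (use assms in \<open>auto simp: no_const_int0\<close>)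

abbreviation "flow_one m x \<equiv> flow m x (graded_map int1 1)"

text \<open>
  The decomposition of the product domain.  Here \<open>G1\<close> and \<open>G2\<close> are the integrals with only the upper
  endpoint left open.  In \<open>G1 * G2\<close> both words run in parallel
  after the later of the two lower endpoints, so the parameters add there.  Closing one upper endpoint at a
  time gives \<open>H1 * G2\<close> and \<open>G1 * H2\<close>, then \<open>H1 * H2\<close>; each step is an instance of the product rule
  and of uniqueness.
\<close>

lemma product_flow:
  fixes m1 m2 x1 x2 :: "'a::{real_algebra_1, comm_ring_1}"
  defines "G1 \<equiv> flow_one m1 x1" and "G2 \<equiv> flow_one m2 x2"
  defines "K \<equiv> graded_map int0 (flow (m1 + m2) (x1 + x2) (graded_map int1 (G1 + G2)))"
  shows "graded_map int0 G1 * graded_map int0 G2 =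
     graded_map int0 (flow m2 x2 (K + graded_map int1 (graded_map int0 G1)) +
                      flow m1 x1 (K + graded_map int1 (graded_map int0 G2)))"
proof -
  let ?U = "embed geom_tail :: 'a graded" and ?L1 = "potential m1 x1" and ?L2 = "potential m2 x2"
  define H1 where "H1 = graded_map int0 G1"
  define H2 where "H2 = graded_map int0 G2"
  have G: "no_const G1" "no_const G2"
    by (auto simp: G1_def G2_def intro!: no_const_flow no_const_int1)
  have H: "no_const H1" "no_const H2" by (auto simp: H1_def H2_def no_const_int0)
  have dG1: "\<theta> G1 = ?L1 * G1 + ?U" and dG2: "\<theta> G2 = ?L2 * G2 + ?U"
    by (auto simp: G1_def G2_def theta_flow no_const_int1 theta_int1)
  have dH1: "\<theta> H1 = G1" and dH2: "\<theta> H2 = G2" using G by (auto simp: H1_def H2_def theta_int0)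
  have GG: "G1 * G2 = flow (m1 + m2) (x1 + x2) (graded_map int1 (G1 + G2))"
  proof (rule eq_flowI)
    show "\<theta> (G1 * G2) = potential (m1 + m2) (x1 + x2) * (G1 * G2) + \<theta> (graded_map int1 (G1 + G2))"
      unfolding theta_mult dG1 dG2 theta_int1 potential_add[symmetric] by (simp only: algebra_simps)
  qed (auto intro!: no_const_mult G no_const_int1)
  have K: "\<theta> K = G1 * G2" using G unfolding K_def GG[symmetric] by (intro theta_int0 no_const_mult)
  have KK: "no_const K" by (simp add: K_def no_const_int0)
  have 1: "H1 * G2 = flow m2 x2 (K + graded_map int1 H1)"
  proof (rule eq_flowI)
    show "\<theta> (H1 * G2) = potential m2 x2 * (H1 * G2) + \<theta> (K + graded_map int1 H1)"
      unfolding theta_mult theta_add dG2 dH1 K theta_int1 by (simp only: algebra_simps)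
  qed (auto intro!: no_const_mult H no_const_int1 no_const_add KK)
  have 2: "G1 * H2 = flow m1 x1 (K + graded_map int1 H2)"
  proof (rule eq_flowI)
    show "\<theta> (G1 * H2) = potential m1 x1 * (G1 * H2) + \<theta> (K + graded_map int1 H2)"
      unfolding theta_mult theta_add dG1 dH2 K theta_int1 by (simp only: algebra_simps)
  qed (auto intro!: no_const_mult G no_const_int1 no_const_add KK)
  have "H1 * H2 = graded_map int0 (H1 * G2 + G1 * H2)"
    by (rule eq_int0I) (auto intro!: no_const_mult no_const_add H G simp: theta_mult dH1 dH2)
  hence "H1 * H2 = graded_map int0 (flow m2 x2 (K + graded_map int1 H1) + flow m1 x1 (K + graded_map int1 H2))"
    by (simp only: 1 2)
  thus ?thesis by (simp only: H1_def H2_def)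
qed

section \<open>Words and indices\<close>

text \<open>
  An exponent \<open>s\<close> stands for one letter \<open>int1\<close> followed by \<open>s - 1\<close> letters \<open>int0\<close>.
\<close>

definition index_step :: "nat \<Rightarrow> real fps \<Rightarrow> real fps" where
  "index_step s f = (int0 ^^ (s - 1)) (int1 f)"

definition polylog :: "nat list \<Rightarrow> real fps" where
  "polylog as = fold index_step as 1"

text \<open>
  The word of an index with its very first letter \<open>int1\<close> left out: \<open>g\<close> stands for the result of
  whatever that first letter is.  With \<open>int1\<close> there it is the usual word of the index, and with \<open>int0\<close> there the
  first entry merges with the last entry of the preceding index.
\<close>

definition run_index :: "real fps \<Rightarrow> nat list \<Rightarrow> real fps" where
  "run_index g as = fold index_step (tl as) ((int0 ^^ (hd as - 1)) g)"

text \<open>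
  A composition ends either in an entry 1 or in a larger entry; on words this is the choice
  of the last letter, and it matches the recursion of \<open>word_sum\<close>.
\<close>

lemma compositions_Suc_Suc:
  "compositions (Suc m) (Suc w) = (\<lambda>as. as @ [1]) ` compositions m w \<union> inc_last ` compositions (Suc m) w"
    (is "?L = ?R")
proof (intro equalityI subsetI)
  fix as assume "as \<in> ?L"
  then obtain bs s where as: "as = bs @ [s]" "length bs = m" "\<forall>a\<in>set bs. 0 < a" "0 < s" "sum_list bs + s = Suc w"
    by (cases as rule: rev_cases) (auto simp: compositions_def)
  show "as \<in> ?R"
  proof (cases "s = 1")
    case True
    with as show ?thesis by (auto simp: compositions_def)
  next
    case False
    with as have "as = inc_last (bs @ [s - 1])" "bs @ [s - 1] \<in> compositions (Suc m) w"
      by (auto simp: compositions_def inc_last_def)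
    thus ?thesis by blast
  qed
next
  fix as assume "as \<in> ?R"
  thus "as \<in> ?L"
  proof
    assume "as \<in> inc_last ` compositions (Suc m) w"
    then obtain bs where "as = inc_last bs" "bs \<in> compositions (Suc m) w" by blast
    thus ?thesis by (cases bs rule: rev_cases) (auto simp: compositions_def inc_last_def)
  qed (auto simp: compositions_def)
qed

lemma compositions_admissible:
  assumes "as \<in> compositions (a + 1) w" shows "as \<noteq> []" "0 < last as" "0 < hd as" "\<forall>s\<in>set as. 0 < s"
proof -
  show *: "as \<noteq> []" "\<forall>s\<in>set as. 0 < s" using assms by (auto simp: compositions_def)
  show "0 < last as" "0 < hd as" using * by simp_all
qed

lemma sum_compositions_Suc_Suc:
  fixes F :: "nat list \<Rightarrow> 'b::comm_monoid_add"
  shows "sum F (compositions (Suc m) (Suc w)) =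
    (\<Sum>as\<in>compositions m w. F (as @ [1])) + (\<Sum>as\<in>compositions (Suc m) w. F (inc_last as))"
proof -
  have disj: "(\<lambda>as. as @ [1]) ` compositions m w \<inter> inc_last ` compositions (Suc m) w = {}"
  proof (rule equals0I)
    fix x assume "x \<in> (\<lambda>as. as @ [1]) ` compositions m w \<inter> inc_last ` compositions (Suc m) w"
    then obtain as bs where "x = as @ [1]" "x = inc_last bs" "bs \<in> compositions (Suc m) w" by blast
    moreover from this have "0 < last bs" using compositions_admissible(2)[of bs m w] by simp
    ultimately show False by (simp add: inc_last_def)
  qed
  have inj: "inj_on inc_last (compositions (Suc m) w)"
  proof (rule inj_onI)
    fix bs cs assume "bs \<in> compositions (Suc m) w" "cs \<in> compositions (Suc m) w" "inc_last bs = inc_last cs"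
    thus "bs = cs"
      by (cases bs rule: rev_cases; cases cs rule: rev_cases) (auto simp: compositions_def inc_last_def)
  qed
  have "sum F (compositions (Suc m) (Suc w)) =
      sum F ((\<lambda>as. as @ [1]) ` compositions m w) + sum F (inc_last ` compositions (Suc m) w)"
    unfolding compositions_Suc_Suc by (intro sum.union_disjoint disj finite_imageI finite_compositions)
  thus ?thesis by (simp add: sum.reindex inj inj_on_def sum.reindex[OF inj])
qed

lemma compositions_eq_empty: "w < m \<Longrightarrow> compositions m w = {}"
proof -
  have "length as \<le> sum_list as" if "\<forall>a\<in>set as. 0 < a" for as :: "nat list"
    using that by (induction as) (auto simp: Suc_le_eq add_strict_increasing)
  thus "w < m \<Longrightarrow> compositions m w = {}" by (fastforce simp: compositions_def)
qed

lemma compositions_0: "compositions 0 w = (if w = 0 then {[]} else {})"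
  by (auto simp: compositions_def)

lemma index_step_inc: "0 < s \<Longrightarrow> index_step (s + 1) f = int0 (index_step s f)"
  by (cases s) (auto simp: index_step_def)

lemma fold_index_step_inc_last:
  assumes "as \<noteq> []" "0 < last as"
  shows "fold index_step (inc_last as) f = int0 (fold index_step as f)"
  using assms by (cases as rule: rev_cases) (auto simp: inc_last_def index_step_inc[simplified])

lemma run_index_snoc: "as \<noteq> [] \<Longrightarrow> run_index g (as @ [1]) = int1 (run_index g as)"
  by (cases as) (auto simp: run_index_def index_step_def)

lemma run_index_inc_last:
  assumes "as \<noteq> []" "0 < last as"
  shows "run_index g (inc_last as) = int0 (run_index g as)"
proof (cases "tl as = []")
  case True
  with assms obtain s where "as = [s]" "0 < s" by (cases as) auto
  thus ?thesis by (cases s) (auto simp: run_index_def inc_last_def)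
next
  case False
  with assms obtain s bs where as: "as = s # bs" "bs \<noteq> []" by (cases as) auto
  hence "inc_last as = s # inc_last bs" by (simp add: inc_last_def)
  thus ?thesis using assms as by (simp add: run_index_def fold_index_step_inc_last)
qed

text \<open>
  Apart from the distinguished first letter, an index with \<open>a + 1\<close> entries and weight \<open>a + b + 1\<close> is an
  arbitrary word with \<open>a\<close> letters \<open>int1\<close> and \<open>b\<close> letters \<open>int0\<close>.
\<close>

lemma sum_run_index:
  "(\<Sum>as\<in>compositions (a + 1) (a + b + 1). run_index g as) = word_sum a b g"
proof -
  define V where "V m w = (\<Sum>as\<in>compositions m w. run_index g as)" for m w
  have inc: "(\<Sum>as\<in>compositions (Suc m) w. run_index g (inc_last as)) = int0 (V (Suc m) w)" for m w
    unfolding V_def int0_sum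
    by (intro sum.cong refl run_index_inc_last) (use compositions_admissible[of _ m w] in auto)
  have V1: "V (Suc (Suc m)) (Suc w) = int1 (V (Suc m) w) + int0 (V (Suc (Suc m)) w)" for m w
  proof -
    have "(\<Sum>as\<in>compositions (Suc m) w. run_index g (as @ [1])) = int1 (V (Suc m) w)"
      unfolding V_def int1_sum
      by (intro sum.cong refl run_index_snoc) (auto simp: compositions_def)
    thus ?thesis unfolding inc[symmetric] by (simp add: V_def sum_compositions_Suc_Suc)
  qed
  have V0: "V 1 (Suc w) = (if w = 0 then g else 0) + int0 (V 1 w)" for w
    using inc[of 0 w] by (simp add: V_def sum_compositions_Suc_Suc compositions_0 run_index_def)
  have V00: "V m w = 0" if "w < m" for m w using that by (simp add: V_def compositions_eq_empty)
  have i0: "int0 0 = (0 :: real fps)" by (rule fps_ext) simp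
  have "V (Suc a) (Suc (a + b)) = word_sum a b f" if "f = g" for f
    using that
  proof (induction a b f rule: word_sum.induct)
    case 1 thus ?case using V0[of 0] by (simp add: V00 i0)
  next
    case (2 a f) thus ?case using V1[of a "Suc a"] by (simp add: V00 i0)
  next
    case (3 b f) thus ?case using V0[of "Suc b"] by simp
  next
    case (4 a b f) thus ?case using V1[of a "Suc (a + Suc b)"] by simp
  qed
  thus ?thesis by (simp add: V_def)
qed

lemma fold_index_step_eq_run_index:
  "as \<noteq> [] \<Longrightarrow> fold index_step as f = run_index (int1 f) as"
  by (cases as) (auto simp: run_index_def index_step_def)

lemma fold_index_step_merge:
  assumes "bs \<noteq> []" "cs \<noteq> []" "0 < last bs" "0 < hd cs"
  shows "fold index_step (merge_lists bs cs) f = run_index (int0 (fold index_step bs f)) cs"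
proof -
  obtain bs' s where bs: "bs = bs' @ [s]" using assms by (cases bs rule: rev_cases) auto
  obtain t cs' where cs: "cs = t # cs'" using assms by (cases cs) auto
  have "s + t - 1 = (t - 1) + Suc (s - 1)" using assms bs cs by auto
  hence "index_step (s + t) h = (int0 ^^ (t - 1)) (int0 (index_step s h))" for h
    unfolding index_step_def by (simp only: funpow_add funpow.simps o_apply)
  thus ?thesis by (simp add: bs cs merge_lists_def run_index_def)
qed

lemma sum_fold_index_step:
  "(\<Sum>as\<in>compositions (a + 1) (a + b + 1). fold index_step as f) = word_sum a b (int1 f)"
  unfolding sum_run_index[symmetric]
  by (intro sum.cong refl fold_index_step_eq_run_index) (auto simp: compositions_def)

text \<open>
  The two intervals are disjoint: the first word is closed by an \<open>int0\<close>, and the second starts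
  with an \<open>int1\<close> after it.
\<close>

lemma sum_polylog_two:
  "(\<Sum>\<alpha>\<in>compositions (a1 + 1) (a1 + b1 + 1). \<Sum>\<beta>\<in>compositions (a2 + 1) (a2 + b2 + 1).
      polylog (inc_last \<alpha> @ inc_last \<beta>))
   = int0 (word_sum a2 b2 (int1 (int0 (word_sum a1 b1 (int1 1)))))"
proof -
  have "(\<Sum>\<beta>\<in>compositions (a2 + 1) (a2 + b2 + 1). polylog (inc_last \<alpha> @ inc_last \<beta>)) =
        int0 (word_sum a2 b2 (int1 (int0 (fold index_step \<alpha> 1))))"
    if "\<alpha> \<in> compositions (a1 + 1) (a1 + b1 + 1)" for \<alpha>
    unfolding sum_fold_index_step[symmetric] int0_sum
    using compositions_admissible[OF that]
    by (intro sum.cong refl) (simp add: polylog_def fold_index_step_inc_last compositions_admissible)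
  hence "(\<Sum>\<alpha>\<in>compositions (a1 + 1) (a1 + b1 + 1). \<Sum>\<beta>\<in>compositions (a2 + 1) (a2 + b2 + 1).
      polylog (inc_last \<alpha> @ inc_last \<beta>)) =
     (\<Sum>\<alpha>\<in>compositions (a1 + 1) (a1 + b1 + 1). int0 (word_sum a2 b2 (int1 (int0 (fold index_step \<alpha> 1)))))"
    by (rule sum.cong[OF refl])
  thus ?thesis
    by (simp only: int0_sum[symmetric] word_sum_sum[symmetric] int1_sum[symmetric] sum_fold_index_step)
qed

lemma inc_last_append: "bs \<noteq> [] \<Longrightarrow> as @ inc_last bs = inc_last (as @ bs)"
  by (simp add: inc_last_def butlast_append)

lemma merge_lists_admissible:
  assumes "bs \<noteq> []" "cs \<noteq> []" "\<forall>s\<in>set bs. 0 < s" "\<forall>s\<in>set cs. 0 < s"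
  shows "merge_lists bs cs \<noteq> []" "\<forall>s\<in>set (merge_lists bs cs). 0 < s"
  using assms by (auto simp: merge_lists_def dest: in_set_butlastD list.set_sel(2))

text \<open>
  The intervals overlap: between the lower endpoints, on the overlap, and between the upper endpoints
  there is one word each.  The first upper endpoint is an \<open>int0\<close> that starts the third word, hence the merged
  entry.
\<close>

lemma sum_polylog_three:
  "(\<Sum>\<alpha>\<in>compositions (a1 + 1) (a1 + b1 + 1). \<Sum>\<beta>\<in>compositions (a2 + 1) (a2 + b2 + 1).
    \<Sum>\<gamma>\<in>compositions (a3 + 1) (a3 + b3 + 1). polylog (\<alpha> @ inc_last (merge_lists \<beta> \<gamma>)))
   = int0 (word_sum a3 b3 (int0 (word_sum a2 b2 (int1 (word_sum a1 b1 (int1 1))))))"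
proof -
  have "(\<Sum>\<gamma>\<in>compositions (a3 + 1) (a3 + b3 + 1). polylog (\<alpha> @ inc_last (merge_lists \<beta> \<gamma>))) =
        int0 (word_sum a3 b3 (int0 (fold index_step \<beta> (fold index_step \<alpha> 1))))"
    if "\<alpha> \<in> compositions (a1 + 1) (a1 + b1 + 1)" "\<beta> \<in> compositions (a2 + 1) (a2 + b2 + 1)" for \<alpha> \<beta>
  proof -
    have "polylog (\<alpha> @ inc_last (merge_lists \<beta> \<gamma>)) =
           int0 (run_index (int0 (fold index_step \<beta> (fold index_step \<alpha> 1))) \<gamma>)"
      if "\<gamma> \<in> compositions (a3 + 1) (a3 + b3 + 1)" for \<gamma>
    proof -
      note \<beta> = compositions_admissible[OF \<open>\<beta> \<in> _\<close>] and \<gamma> = compositions_admissible[OF that]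
      note m = merge_lists_admissible[OF \<beta>(1) \<gamma>(1) \<beta>(4) \<gamma>(4)]
      have "0 < last (merge_lists \<beta> \<gamma>)" using m by (meson last_in_set)
      hence "polylog (\<alpha> @ inc_last (merge_lists \<beta> \<gamma>)) =
              int0 (fold index_step (merge_lists \<beta> \<gamma>) (fold index_step \<alpha> 1))"
        by (simp only: polylog_def fold_append o_apply fold_index_step_inc_last[OF m(1)])
      also have "\<dots> = int0 (run_index (int0 (fold index_step \<beta> (fold index_step \<alpha> 1))) \<gamma>)"
        by (simp only: fold_index_step_merge[OF \<beta>(1) \<gamma>(1) \<beta>(2) \<gamma>(3)])
      finally show ?thesis .
    qed
    thus ?thesis unfolding sum_run_index[symmetric] int0_sum by (intro sum.cong refl)
  qed
  hence "(\<Sum>\<alpha>\<in>compositions (a1 + 1) (a1 + b1 + 1). \<Sum>\<beta>\<in>compositions (a2 + 1) (a2 + b2 + 1).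
    \<Sum>\<gamma>\<in>compositions (a3 + 1) (a3 + b3 + 1). polylog (\<alpha> @ inc_last (merge_lists \<beta> \<gamma>))) =
    (\<Sum>\<alpha>\<in>compositions (a1 + 1) (a1 + b1 + 1). \<Sum>\<beta>\<in>compositions (a2 + 1) (a2 + b2 + 1).
       int0 (word_sum a3 b3 (int0 (fold index_step \<beta> (fold index_step \<alpha> 1)))))"
    by (intro sum.cong refl)
  thus ?thesis
    by (simp only: int0_sum[symmetric] word_sum_sum[symmetric] int1_sum[symmetric] sum_fold_index_step)
qed

section \<open>Multiple zeta values as sums of coefficients\<close>

text \<open>
  A decay rate that both letters preserve and that one more \<open>int0\<close> turns into summability.  The
  exponent \<open>1/2\<close> could be any number in \<open>(0, 1)\<close>; with exponent 1 the letter \<open>int1\<close> would create a logarithm.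
  At \<open>n = 0\<close> the bound reads \<open>C / 0 = 0\<close>, so the constant term vanishes.
\<close>

definition sqrt_decay :: "real fps \<Rightarrow> bool" where
  "sqrt_decay f \<longleftrightarrow> (\<exists>C. \<forall>n. \<bar>f $ n\<bar> \<le> C / sqrt (real n))"

lemma sqrt_decayE:
  assumes "sqrt_decay f"
  obtains C where "0 \<le> C" "\<And>n. \<bar>f $ n\<bar> \<le> C / sqrt (real n)"
proof -
  obtain C where C: "\<And>n. \<bar>f $ n\<bar> \<le> C / sqrt (real n)" using assms by (auto simp: sqrt_decay_def)
  from C[of 1] have "0 \<le> C" by simp
  thus ?thesis using C that by blast
qed

lemma sqrt_decay_add:
  assumes "sqrt_decay f" "sqrt_decay g" shows "sqrt_decay (f + g)"
proof -
  obtain C D where C: "\<And>n. \<bar>f $ n\<bar> \<le> C / sqrt (real n)" and D: "\<And>n. \<bar>g $ n\<bar> \<le> D / sqrt (real n)"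
    using assms by (metis sqrt_decayE)
  have "\<bar>(f + g) $ n\<bar> \<le> (C + D) / sqrt (real n)" for n
    using abs_triangle_ineq[of "f $ n" "g $ n"] C[of n] D[of n] by (simp add: add_divide_distrib)
  thus ?thesis unfolding sqrt_decay_def by blast
qed

lemma sum_inverse_sqrt_le: "(\<Sum>m<n. 1 / sqrt (real m)) \<le> 2 * sqrt (real n)"
proof -
  have "(\<Sum>m<Suc n. 1 / sqrt (real m)) \<le> 2 * sqrt (real n)"
  proof (induction n)
    case (Suc n)
    define a b where "a = sqrt (real n)" and "b = sqrt (real (Suc n))"
    have b: "b > 0" and ab: "b\<^sup>2 = a\<^sup>2 + 1" by (auto simp: a_def b_def)
    have "0 \<le> (b - a)\<^sup>2" by simp
    hence "1 \<le> 2 * (b - a) * b" using ab by (simp add: power2_eq_square algebra_simps)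
    hence "1 / b \<le> 2 * (b - a)" using b by (simp add: pos_divide_le_eq)
    thus ?case using Suc by (simp add: a_def b_def)
  qed simp
  moreover have "(\<Sum>m<n. 1 / sqrt (real m)) \<le> (\<Sum>m<Suc n. 1 / sqrt (real m))" by simp
  ultimately show ?thesis by linarith
qed

lemma sqrt_decay_int0:
  assumes "sqrt_decay f" shows "sqrt_decay (int0 f)"
proof -
  obtain C where C: "0 \<le> C" "\<And>n. \<bar>f $ n\<bar> \<le> C / sqrt (real n)" using assms by (rule sqrt_decayE) blast
  have "\<bar>int0 f $ n\<bar> \<le> C / sqrt (real n)" for n
  proof (cases "n = 0")
    case False
    have "\<bar>int0 f $ n\<bar> = \<bar>f $ n\<bar> / real n" by (simp add: abs_mult)
    also have "\<dots> \<le> \<bar>f $ n\<bar>" using False divide_left_mono[of 1 "real n" "\<bar>f $ n\<bar>"] by simp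
    finally show ?thesis using C(2)[of n] by linarith
  qed simp
  thus ?thesis unfolding sqrt_decay_def by blast
qed

lemma sqrt_decay_int1:
  assumes "sqrt_decay f" shows "sqrt_decay (int1 f)"
proof -
  obtain C where C: "0 \<le> C" "\<And>n. \<bar>f $ n\<bar> \<le> C / sqrt (real n)" using assms by (rule sqrt_decayE) blast
  have "\<bar>int1 f $ n\<bar> \<le> (2 * C) / sqrt (real n)" for n
  proof (cases "n = 0")
    case False
    have "\<bar>\<Sum>m<n. f $ m\<bar> \<le> (\<Sum>m<n. C * (1 / sqrt (real m)))"
      using C(2) by (intro order_trans[OF sum_abs] sum_mono) simp
    also have "\<dots> \<le> C * (2 * sqrt (real n))"
      unfolding sum_distrib_left[symmetric] by (intro mult_left_mono sum_inverse_sqrt_le C(1))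
    finally have "\<bar>int1 f $ n\<bar> \<le> (C * (2 * sqrt (real n))) / real n"
      by (simp add: abs_mult divide_right_mono)
    also have "\<dots> = (2 * C) * (sqrt (real n) / real n)" by simp
    also have "sqrt (real n) / real n = 1 / sqrt (real n)"
      using real_div_sqrt[of "real n"] False by (simp add: field_simps)
    finally show ?thesis by simp
  qed simp
  thus ?thesis unfolding sqrt_decay_def by blast
qed

lemma sqrt_decay_int1_1: "sqrt_decay (int1 1)"
proof -
  have "\<bar>int1 1 $ n\<bar> \<le> 1 / sqrt (real n)" for n :: nat
  proof (cases "n = 0")
    case False
    have "(\<Sum>m<n. (1 :: real fps) $ m) = (\<Sum>m<n. if m = 0 then 1 else 0)"
      by (intro sum.cong) auto
    hence "(\<Sum>m<n. (1 :: real fps) $ m) = 1" using False by simp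
    moreover have "sqrt (real n) \<le> real n" using False by (simp add: real_le_lsqrt power2_eq_square)
    ultimately show ?thesis using False by (simp add: frac_le)
  qed simp
  thus ?thesis unfolding sqrt_decay_def by blast
qed

lemma sqrt_decay_word_sum: "sqrt_decay f \<Longrightarrow> sqrt_decay (word_sum a b f)"
  by (induction a b f rule: word_sum.induct) (auto intro: sqrt_decay_add sqrt_decay_int0 sqrt_decay_int1)

lemma summable_int0:
  assumes "sqrt_decay f" shows "summable (\<lambda>n. \<bar>int0 f $ n\<bar>)"
proof -
  obtain C where C: "0 \<le> C" "\<And>n. \<bar>f $ n\<bar> \<le> C / sqrt (real n)" using assms by (rule sqrt_decayE) blast
  show ?thesis
  proof (rule summable_comparison_test')
    have "summable (\<lambda>n. real n powr (- 3/2))" by (subst summable_real_powr_iff) simp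
    thus "summable (\<lambda>n. C * real n powr (- 3/2))" by (rule summable_mult)
  next
    fix n :: nat
    show "norm \<bar>int0 f $ n\<bar> \<le> C * real n powr (- 3/2)"
    proof (cases "n = 0")
      case False
      have "norm \<bar>int0 f $ n\<bar> = \<bar>f $ n\<bar> / real n" by (simp add: abs_mult)
      also have "\<dots> \<le> (C / sqrt (real n)) / real n" by (intro divide_right_mono C) simp
      also have "\<dots> = C * real n powr (- 3/2)"
      proof -
        have "real n powr (3/2) = real n powr (1 + 1/2)" by simp
        also have "\<dots> = real n * sqrt (real n)" using False unfolding powr_add by (simp add: powr_half_sqrt)
        finally show ?thesis using False by (simp add: powr_minus field_simps)
      qed
      finally show ?thesis .
    qed simp
  qed
qed

lemma sqrt_decay_int0_funpow: "sqrt_decay f \<Longrightarrow> sqrt_decay ((int0 ^^ k) f)"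
  by (induction k) (auto intro: sqrt_decay_int0)

lemma sqrt_decay_polylog: "as \<noteq> [] \<Longrightarrow> sqrt_decay (polylog as)"
proof (induction as rule: rev_induct)
  case (snoc s as)
  have "sqrt_decay (int1 (polylog as))"
    using snoc.IH sqrt_decay_int1_1 by (cases "as = []") (auto simp: polylog_def intro: sqrt_decay_int1)
  thus ?case by (simp add: polylog_def index_step_def sqrt_decay_int0_funpow)
qed simp

text \<open>
  The tuples of \<open>increasing_tuples\<close> with prescribed largest entry.  Prepending 0 expresses
  positivity of the entries through sortedness and gives the empty tuple the largest entry 0.
\<close>

definition tuples_to :: "nat \<Rightarrow> nat \<Rightarrow> nat list set" where
  "tuples_to n N = {ls. length ls = n \<and> sorted_wrt (<) (0 # ls) \<and> last (0 # ls) = N}"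

lemma tuples_to_0: "tuples_to 0 N = (if N = 0 then {[]} else {})"
  by (auto simp: tuples_to_def)

lemma sorted_wrt_snoc_iff:
  "sorted_wrt (<) (xs @ [N]) \<longleftrightarrow> sorted_wrt (<) xs \<and> (xs = [] \<or> last xs < N)" for N :: nat
  by (induction xs rule: rev_induct) (auto simp: sorted_wrt_append)

lemma tuples_to_Suc: "tuples_to (Suc n) N = (\<lambda>ls. ls @ [N]) ` (\<Union>M<N. tuples_to n M)"
proof (intro equalityI subsetI)
  fix ls assume *: "ls \<in> tuples_to (Suc n) N"
  then obtain ms where ls: "ls = ms @ [N]" by (cases ls rule: rev_cases) (auto simp: tuples_to_def)
  have "ms \<in> tuples_to n (last (0 # ms))" "last (0 # ms) < N"
    using * sorted_wrt_snoc_iff[of "0 # ms" N] by (auto simp: tuples_to_def ls)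
  thus "ls \<in> (\<lambda>ls. ls @ [N]) ` (\<Union>M<N. tuples_to n M)" using ls by blast
next
  fix ls assume "ls \<in> (\<lambda>ls. ls @ [N]) ` (\<Union>M<N. tuples_to n M)"
  then obtain ms M where "ls = ms @ [N]" "M < N" "ms \<in> tuples_to n M" by blast
  thus "ls \<in> tuples_to (Suc n) N"
    using sorted_wrt_snoc_iff[of "0 # ms" N] by (auto simp: tuples_to_def)
qed

lemma finite_tuples_to: "finite (tuples_to n N)"
  by (induction n arbitrary: N) (auto simp: tuples_to_0 tuples_to_Suc)

lemma int0_funpow_nth: "(int0 ^^ k) f $ n = f $ n / real n ^ k" for f :: "real fps"
  by (induction k) (auto simp: field_simps)

text \<open>
  The coefficient of \<open>t\<close> to the power \<open>N\<close> is the part of the multiple sum with largest summation index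
  \<open>N\<close>: the letter \<open>int1\<close> sums over smaller indices, and each of the \<open>s\<close> letters of the last entry divides by \<open>N\<close>.
\<close>

lemma polylog_nth:
  assumes "\<forall>s\<in>set as. 0 < s"
  shows "polylog as $ N = (\<Sum>ls\<in>tuples_to (length as) N. 1 / (\<Prod>i<length as. real (ls ! i) ^ (as ! i)))"
  using assms
proof (induction as arbitrary: N rule: rev_induct)
  case Nil
  thus ?case by (auto simp: polylog_def tuples_to_0)
next
  case (snoc s as)
  let ?t = "\<lambda>as ls. 1 / (\<Prod>i<length as. real (ls ! i) ^ (as ! i))"
  obtain s' where s: "s = Suc s'" using snoc.prems by (cases s) auto
  have "polylog (as @ [s]) $ N = (\<Sum>M<N. polylog as $ M) / real N ^ s"
    by (simp add: polylog_def index_step_def int0_funpow_nth s field_simps)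
  also have "(\<Sum>M<N. polylog as $ M) = (\<Sum>M<N. \<Sum>ls\<in>tuples_to (length as) M. ?t as ls)"
    using snoc by simp
  also have "\<dots> = (\<Sum>ls\<in>(\<Union>M<N. tuples_to (length as) M). ?t as ls)"
    by (rule sum.UNION_disjoint[symmetric]) (auto simp: finite_tuples_to, auto simp: tuples_to_def)
  also have "\<dots> / real N ^ s = (\<Sum>ls\<in>(\<Union>M<N. tuples_to (length as) M). ?t (as @ [s]) (ls @ [N]))"
    unfolding sum_divide_distrib
  proof (intro sum.cong refl)
    fix ls assume "ls \<in> (\<Union>M<N. tuples_to (length as) M)"
    hence l: "length ls = length as" by (auto simp: tuples_to_def)
    hence "(\<Prod>i<length as. real ((ls @ [N]) ! i) ^ ((as @ [s]) ! i)) = (\<Prod>i<length as. real (ls ! i) ^ (as ! i))"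
      by (intro prod.cong) (auto simp: nth_append)
    thus "?t as ls / real N ^ s = ?t (as @ [s]) (ls @ [N])" using l by (simp add: nth_append)
  qed
  also have "\<dots> = (\<Sum>ls\<in>tuples_to (length (as @ [s])) N. ?t (as @ [s]) ls)"
    by (simp add: tuples_to_Suc sum.reindex inj_on_def)
  finally show ?case .
qed

lemma polylog_sums_mzv:
  assumes "as \<noteq> []" "\<forall>s\<in>set as. 0 < s"
  shows "(\<lambda>n. polylog (inc_last as) $ n) sums mzv (inc_last as)"
proof -
  let ?bs = "inc_last as"
  let ?t = "\<lambda>ls. 1 / (\<Prod>i<length ?bs. real (ls ! i) ^ (?bs ! i))"
  let ?T = "tuples_to (length ?bs)"
  have pos: "\<forall>s\<in>set ?bs. 0 < s" using assms by (auto simp: inc_last_def dest: in_set_butlastD)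
  have fin: "((\<lambda>ls. ?t ls) has_sum polylog ?bs $ N) (?T N)" for N
    unfolding polylog_nth[OF pos] by (intro has_sum_finite finite_tuples_to)
  have "polylog ?bs = int0 (polylog as)"
    unfolding polylog_def using assms by (intro fold_index_step_inc_last) auto
  hence sum: "summable (\<lambda>n. polylog ?bs $ n)" using summable_int0[OF sqrt_decay_polylog[OF assms(1)]]
    by (simp only: summable_rabs_cancel)
  have nn: "0 \<le> polylog ?bs $ n" for n
    unfolding polylog_nth[OF pos] by (intro sum_nonneg) (auto intro!: divide_nonneg_nonneg prod_nonneg)
  have S: "((\<lambda>n. polylog ?bs $ n) has_sum (\<Sum>n. polylog ?bs $ n)) UNIV"
    by (rule sums_nonneg_imp_has_sum[OF summable_sums[OF sum] nn])
  have "(case_prod (\<lambda>N. ?t) has_sum (\<Sum>n. polylog ?bs $ n)) (Sigma UNIV ?T)"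
  proof (rule has_sum_SigmaI[OF _ S])
    show "case_prod (\<lambda>N. ?t) summable_on Sigma UNIV ?T"
    proof (rule summable_on_SigmaI[where g = "\<lambda>n. polylog ?bs $ n"])
      show "(\<lambda>n. polylog ?bs $ n) summable_on UNIV" using S by (rule has_sum_imp_summable)
    qed (use fin in \<open>auto intro!: divide_nonneg_nonneg prod_nonneg\<close>)
  qed (use fin in auto)
  also have "(case_prod (\<lambda>N. ?t) has_sum (\<Sum>n. polylog ?bs $ n)) (Sigma UNIV ?T) \<longleftrightarrow>
             (?t has_sum (\<Sum>n. polylog ?bs $ n)) (increasing_tuples (length ?bs))"
    by (rule has_sum_reindex_bij_witness[of _ "\<lambda>ls. (last (0 # ls), ls)" snd])
       (auto simp: tuples_to_def increasing_tuples_def)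
  finally have "mzv ?bs = (\<Sum>n. polylog ?bs $ n)"
    unfolding mzv_def by (rule infsumI)
  thus ?thesis using summable_sums[OF sum] by simp
qed

section \<open>The sum formula\<close>

lemma sums_swap_nonneg:
  fixes a :: "nat \<Rightarrow> nat \<Rightarrow> real"
  assumes nonneg: "\<And>i j. 0 \<le> a i j"
    and rows: "\<And>i. a i sums r i" and total: "r sums s"
    and columns: "\<And>j. (\<lambda>i. a i j) sums c j"
  shows "c sums s"
proof -
  have r: "((\<lambda>j. a i j) has_sum r i) UNIV" and c: "((\<lambda>i. a i j) has_sum c j) UNIV" for i j
    using rows columns nonneg by (auto intro: sums_nonneg_imp_has_sum)
  have "0 \<le> r i" for i by (rule has_sum_nonneg[OF r]) (use nonneg in auto)
  hence s: "(r has_sum s) UNIV" using total by (intro sums_nonneg_imp_has_sum)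
  have "(case_prod a has_sum s) (UNIV \<times> UNIV)"
  proof (rule has_sum_SigmaI[OF _ s])
    show "case_prod a summable_on UNIV \<times> UNIV"
      by (rule summable_on_SigmaI[where g = r]) (use r s nonneg in \<open>auto simp: summable_on_def\<close>)
  qed (use r in auto)
  hence "((\<lambda>(j, i). a i j) has_sum s) (UNIV \<times> UNIV)"
    by (subst has_sum_swap) simp
  hence "(c has_sum s) UNIV" by (rule has_sum_SigmaD) (use c in auto)
  thus ?thesis by (rule has_sum_imp_sums)
qed

text \<open>
  The factor \<open>(1 - x)\<^sub>n (1 - x)\<^sub>m / (1 - x)\<^sub>n\<^sub>+\<^sub>m\<close> of a connected sum.  It is 1 when \<open>n\<close> or \<open>m\<close> is
  zero, so it is invisible at the start and at the end of the transport.
\<close>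

definition connector :: "real \<Rightarrow> nat \<Rightarrow> nat \<Rightarrow> real" where
  "connector x n m = pochhammer (1 - x) n * pochhammer (1 - x) m / pochhammer (1 - x) (n + m)"

lemma connector_commute: "connector x n m = connector x m n"
  by (simp add: connector_def add.commute mult.commute)

lemma pochhammer_1_minus_pos: "x < 1 \<Longrightarrow> 0 < pochhammer (1 - x) n" for x :: real
  by (rule pochhammer_pos) simp

lemma connector_0 [simp]: "x < 1 \<Longrightarrow> connector x 0 m = 1" "x < 1 \<Longrightarrow> connector x n 0 = 1"
  using pochhammer_1_minus_pos[of x m] pochhammer_1_minus_pos[of x n] by (auto simp: connector_def)

lemma connector_nonneg: "x < 1 \<Longrightarrow> 0 \<le> connector x n m"
  using pochhammer_1_minus_pos[of x] by (simp add: connector_def less_imp_le)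

lemma connector_Suc:
  "x < 1 \<Longrightarrow> connector x (Suc n) m = connector x n m * ((1 - x + real n) / (1 - x + real n + real m))"
  by (simp add: connector_def pochhammer_Suc algebra_simps)

lemma connector_telescope:
  assumes "x < 1"
  shows "connector x n m - connector x (Suc n) m = real m * (connector x (Suc n) m / (real (Suc n) - x))"
proof -
  define u where "u = 1 - x + real n"
  have u: "u > 0" "u + real m > 0" using assms by (auto simp: u_def)
  have "connector x (Suc n) m = connector x n m * (u / (u + real m))" "real (Suc n) - x = u"
    using connector_Suc[OF assms] by (auto simp: u_def)
  thus ?thesis using u by (simp add: divide_simps) (simp add: algebra_simps)
qed

lemma connector_tendsto_0:
  assumes "x < 1" "0 < m"
  shows "(\<lambda>n. connector x n m) \<longlonglongrightarrow> 0"
proof -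
  obtain k where m: "m = Suc k" using assms by (cases m) auto
  have le1: "connector x n k \<le> 1" for n
  proof (induction k)
    case (Suc k)
    have "connector x n (Suc k) = connector x n k * ((1 - x + real k) / (1 - x + real k + real n))"
      using connector_Suc[OF assms(1), of k n] by (simp add: connector_commute)
    also have "\<dots> \<le> 1 * 1"
      using assms by (intro mult_mono Suc) auto
    finally show ?case by simp
  qed (use assms in simp)
  have bound: "connector x n m \<le> (1 - x + real k) / (1 - x + real k + real n)" for n
  proof -
    have "connector x n m = connector x n k * ((1 - x + real k) / (1 - x + real k + real n))"
      using connector_Suc[OF assms(1), of k n] by (simp add: connector_commute m)
    also have "\<dots> \<le> 1 * ((1 - x + real k) / (1 - x + real k + real n))"
      using assms by (intro mult_right_mono le1) auto
    finally show ?thesis by simp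
  qed
  have "(\<lambda>n. (1 - x + real k) / (1 - x + real k + real n)) \<longlonglongrightarrow> 0"
    by (intro tendsto_divide_0[OF tendsto_const] filterlim_at_top_imp_at_infinity
        filterlim_tendsto_add_at_top[OF tendsto_const] filterlim_real_sequentially)
  from tendsto_sandwich[OF _ _ tendsto_const this] show ?thesis
    using bound connector_nonneg[OF assms(1)] by simp
qed

text \<open>
  Summing over an index \<open>n > q\<close> with weight \<open>1 / (n - x)\<close> telescopes to the value at \<open>q\<close> times
  \<open>1 / m\<close>: the entry is removed from one side of the connected sum and reappears on the other.
\<close>

lemma connector_transport:
  assumes "x < 1" "0 < m"
  shows "(\<lambda>n. if q < n then connector x n m / (real n - x) else 0) sums (connector x q m / real m)"
proof -
  have "(\<lambda>n. connector x (n + q) m) \<longlonglongrightarrow> 0"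
    by (rule LIMSEQ_ignore_initial_segment[OF connector_tendsto_0[OF assms]])
  from telescope_sums'[OF this]
  have "(\<lambda>n. real m * (connector x (Suc n + q) m / (real (Suc n + q) - x))) sums connector x q m"
    using connector_telescope[OF assms(1)] by simp
  from sums_divide[OF this, of "real m"]
  have "(\<lambda>n. connector x (n + Suc q) m / (real (n + Suc q) - x)) sums (connector x q m / real m)"
    using assms(2) by simp
  thus ?thesis by (subst sums_zero_iff_shift[where n = "Suc q", symmetric]) auto
qed

text \<open>
  The sum of \<open>1 / ((n\<^sub>1 - x) \<dots> (n\<^sub>a - x))\<close> over \<open>0 < n\<^sub>1 < \<dots> < n\<^sub>a = n\<close>.  For \<open>a = 0\<close>
  the empty tuple counts as ending at 0, which lets the recursion start.
\<close>

fun perturbed_sum :: "real \<Rightarrow> nat \<Rightarrow> nat \<Rightarrow> real" where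
  "perturbed_sum x 0 n = (if n = 0 then 1 else 0)"
| "perturbed_sum x (Suc a) n = (if n = 0 then 0 else (\<Sum>m<n. perturbed_sum x a m) / (real n - x))"

lemma perturbed_sum_nonneg: "x < 1 \<Longrightarrow> 0 \<le> perturbed_sum x a n"
proof (induction a arbitrary: n)
  case (Suc a)
  show ?case
  proof (cases "n = 0")
    case False
    hence "real n - x \<ge> 0" using Suc.prems by linarith
    thus ?thesis using Suc by (auto intro!: divide_nonneg_nonneg sum_nonneg)
  qed simp
qed simp

text \<open>
  Repeated transport empties the nested sum: each of its \<open>a\<close> indices leaves a factor \<open>1 / m\<close>.
\<close>

lemma perturbed_sum_connector:
  assumes "x < 1" "0 < m"
  shows "(\<lambda>n. perturbed_sum x a n * connector x n m) sums (1 / real m ^ a)"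
proof (induction a)
  case 0
  have "(\<lambda>n. perturbed_sum x 0 n * connector x n m) = (\<lambda>n. if n = 0 then 1 else 0)"
    using assms by auto
  thus ?case using sums_single[of 0 "\<lambda>_. 1 :: real"] by simp
next
  case (Suc a)
  let ?a = "\<lambda>q n. perturbed_sum x a q * (if q < n then connector x n m / (real n - x) else 0)"
  show ?case
  proof (rule sums_swap_nonneg[where a = ?a])
    show "?a q sums (perturbed_sum x a q * (connector x q m / real m))" for q
      by (intro sums_mult connector_transport assms)
    show "(\<lambda>q. perturbed_sum x a q * (connector x q m / real m)) sums (1 / real m ^ Suc a)"
      using sums_divide[OF Suc, of "real m"] by (simp add: mult.commute)
    show "(\<lambda>q. ?a q n) sums (perturbed_sum x (Suc a) n * connector x n m)" for n
    proof -
      have "(\<lambda>q. ?a q n) sums (\<Sum>q<n. ?a q n)"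
        by (rule sums_finite) auto
      also have "(\<Sum>q<n. ?a q n) = (\<Sum>q<n. perturbed_sum x a q) * (connector x n m / (real n - x))"
        unfolding sum_distrib_right by (intro sum.cong) auto
      finally show ?thesis by (cases "n = 0") auto
    qed
    show "0 \<le> ?a q n" for q n
      using assms by (auto intro!: mult_nonneg_nonneg divide_nonneg_nonneg perturbed_sum_nonneg connector_nonneg)
  qed
qed

text \<open>
  Write \<open>1 / n\<close> as the sum over \<open>m > 0\<close> of \<open>connector x n m / (m - x)\<close>, by transport towards 0, and
  then exchange the two summations.
\<close>

lemma perturbed_duality:
  assumes "x < 1" "(\<lambda>m. 1 / (real m ^ Suc a * (real m - x))) sums R"
  shows "(\<lambda>n. perturbed_sum x (Suc a) n / real n) sums R"
proof (rule sums_swap_nonneg)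
  let ?a = "\<lambda>m n. perturbed_sum x (Suc a) n * (if 0 < m then connector x n m / (real m - x) else 0)"
  show "?a m sums (1 / (real m ^ Suc a * (real m - x)))" for m
  proof (cases "m = 0")
    case False
    thus ?thesis using sums_divide[OF perturbed_sum_connector[OF assms(1), of m "Suc a"], of "real m - x"]
      by simp
  qed simp
  show "(\<lambda>m. ?a m n) sums (perturbed_sum x (Suc a) n / real n)" for n
  proof (cases "n = 0")
    case False
    have "(\<lambda>m. if 0 < m then connector x n m / (real m - x) else 0) sums (1 / real n)"
    proof -
      have "(\<lambda>m. if 0 < m then connector x n m / (real m - x) else 0) =
            (\<lambda>m. if 0 < m then connector x m n / (real m - x) else 0)"
        by (rule ext) (simp add: connector_commute[of x n])
      thus ?thesis using connector_transport[of x n 0] False assms(1) by simp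
    qed
    from sums_mult[OF this, of "perturbed_sum x (Suc a) n"] show ?thesis by simp
  qed simp
  show "0 \<le> ?a m n" for m n
    using assms by (auto intro!: mult_nonneg_nonneg divide_nonneg_nonneg perturbed_sum_nonneg connector_nonneg
        simp del: perturbed_sum.simps)
qed (rule assms)

lemma word_sum_nonneg:
  fixes f :: "real fps"
  shows "(\<And>n. 0 \<le> f $ n) \<Longrightarrow> 0 \<le> word_sum a b f $ n"
  by (induction a b f arbitrary: n rule: word_sum.induct) (auto intro!: sum_nonneg add_nonneg_nonneg divide_nonneg_nonneg)

lemma sums_geometric_recurrence:
  fixes c d :: "nat \<Rightarrow> real"
  assumes "c 0 = d 0" "\<And>b. c (Suc b) = r * c b + d (Suc b)" "0 \<le> r" "r < 1" "d sums D" "\<And>b. 0 \<le> d b"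
  shows "c sums (D / (1 - r))"
proof -
  have c: "c b = (\<Sum>i\<le>b. d i * r ^ (b - i))" for b
  proof (induction b)
    case (Suc b)
    have "(\<Sum>i\<le>Suc b. d i * r ^ (Suc b - i)) = (\<Sum>i\<le>b. r * (d i * r ^ (b - i))) + d (Suc b)"
      by (simp add: Suc_diff_le mult_ac)
    thus ?case using Suc assms(2)[of b] by (simp add: sum_distrib_left)
  qed (use assms in simp)
  have "(\<lambda>b. \<Sum>i\<le>b. d i * r ^ (b - i)) sums ((\<Sum>b. d b) * (\<Sum>b. r ^ b))"
    using assms by (intro Cauchy_product_sums) (auto simp: sums_iff summable_geometric)
  thus ?thesis using assms by (simp add: c[abs_def] sums_iff suminf_geometric)
qed

text \<open>
  In the generating function over \<open>b\<close> an arbitrary number of letters \<open>int0\<close> may follow each \<open>int1\<close>; the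
  geometric series in \<open>x / n\<close> replaces the denominators \<open>n\<close> by \<open>n - x\<close>.
\<close>

lemma word_sum_generating_function:
  assumes "0 \<le> x" "x < 1"
  shows "(\<lambda>b. x ^ b * word_sum a b (int1 1) $ n) sums perturbed_sum x (Suc a) n"
proof (cases "n = 0")
  case True
  thus ?thesis by (simp add: word_sum_nth_0)
next
  case n: False
  have x: "0 \<le> x / real n" "x / real n < 1" "real n - x > 0" using n assms by (auto simp: field_simps)
  have eq: "(S / real n) / (1 - x / real n) = S / (real n - x)" for S using n x by (simp add: field_simps)
  show ?thesis using n x
  proof (induction a arbitrary: n)
    case 0
    have one: "(\<Sum>m<n. (1 :: real fps) $ m) = 1" "(\<Sum>m<n. if m = 0 then 1 else 0) = (1::real)"
      using 0 by (auto simp: sum.If_cases)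
    have "(\<lambda>b. x ^ b * word_sum 0 b (int1 1) $ n) sums ((1 / real n) / (1 - x / real n))"
    proof (rule sums_geometric_recurrence)
      show "(\<lambda>b. if b = 0 then 1 / real n else 0) sums (1 / real n)"
        using sums_single[of 0 "\<lambda>_. 1 / real n"] by simp
    qed (use 0 one in auto)
    also have "(1 / real n) / (1 - x / real n) = perturbed_sum x 1 n"
      using 0 one by (simp add: field_simps)
    finally show ?case by simp
  next
    case (Suc a)
    have IH: "(\<lambda>b. x ^ b * word_sum a b (int1 1) $ m) sums perturbed_sum x (Suc a) m" for m
    proof (cases "m = 0")
      case True
      thus ?thesis by (simp add: word_sum_nth_0)
    next
      case False
      thus ?thesis using assms by (intro Suc.IH) (auto simp: field_simps)
    qed
    let ?d = "\<lambda>b. (\<Sum>m<n. x ^ b * word_sum a b (int1 1) $ m) / real n"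
    have "(\<lambda>b. x ^ b * word_sum (Suc a) b (int1 1) $ n) sums
            (((\<Sum>m<n. perturbed_sum x (Suc a) m) / real n) / (1 - x / real n))"
    proof (rule sums_geometric_recurrence)
      show "?d sums ((\<Sum>m<n. perturbed_sum x (Suc a) m) / real n)"
        by (intro sums_divide sums_sum IH)
      show "0 \<le> ?d b" for b
        using assms by (intro divide_nonneg_nonneg sum_nonneg mult_nonneg_nonneg word_sum_nonneg) auto
      show "x ^ 0 * word_sum (Suc a) 0 (int1 1) $ n = ?d 0" by simp
      show "x ^ Suc b * word_sum (Suc a) (Suc b) (int1 1) $ n =
             (x / real n) * (x ^ b * word_sum (Suc a) b (int1 1) $ n) + ?d (Suc b)" for b
        by (simp add: field_simps sum_distrib_left sum_divide_distrib)
    qed (use Suc in auto)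
    also have "((\<Sum>m<n. perturbed_sum x (Suc a) m) / real n) / (1 - x / real n) = perturbed_sum x (Suc (Suc a)) n"
      using Suc.prems by (simp add: field_simps)
    finally show ?case .
  qed
qed

lemma zeta_sums: "(\<lambda>n. 1 / real n ^ (w + 2)) sums mzv [w + 2]"
proof -
  have "polylog [w + 2] $ n = 1 / real n ^ (w + 2)" for n
  proof (cases "n = 0")
    case False
    have "(\<Sum>m<n. (1 :: real fps) $ m) = (\<Sum>m<n. if m = 0 then 1 else 0)" by (intro sum.cong) auto
    thus ?thesis using False by (simp add: polylog_def index_step_def int0_funpow_nth field_simps)
  qed (simp add: polylog_def index_step_def)
  thus ?thesis using polylog_sums_mzv[of "[w + 1]"] by (simp add: inc_last_def)
qed

text \<open>
  Equality is only assumed for \<open>x \<ge> 0\<close>, since the interchanges of summation below need nonnegative terms; this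
  suffices because a nonzero power series has no zeros accumulating at 0.
\<close>

lemma powser_coeffs_unique:
  fixes c d :: "nat \<Rightarrow> real"
  assumes "\<And>x. 0 \<le> x \<Longrightarrow> x < 1 \<Longrightarrow> \<exists>s. (\<lambda>n. c n * x ^ n) sums s \<and> (\<lambda>n. d n * x ^ n) sums s"
  shows "c = d"
proof (rule ext, rule ccontr)
  fix m assume m: "c m \<noteq> d m"
  define e where "e n = c n - d n" for n
  have e: "(\<lambda>n. e n * x ^ n) sums 0" if x: "0 \<le> x" "x < 1" for x
  proof -
    from assms[OF x] obtain s where "(\<lambda>n. c n * x ^ n) sums s" "(\<lambda>n. d n * x ^ n) sums s" by blast
    from sums_diff[OF this] show ?thesis by (simp add: e_def left_diff_distrib)
  qed
  have "(\<lambda>n. e n * 0 ^ n) sums 0" by (rule e) auto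
  hence e0: "e 0 = 0" by (rule sums_unique2[OF powser_sums_zero])
  have "m > 0" using e0 m by (cases m) (auto simp: e_def)
  define f where "f x = (\<Sum>n. e n * x ^ n)" for x :: real
  have "(\<lambda>n. e n * x ^ n) sums f x" if "norm x < 1" for x
  proof -
    have "summable (\<lambda>n. e n * ((1 + \<bar>x\<bar>) / 2) ^ n)"
      using that by (intro sums_summable[OF e]) auto
    hence "summable (\<lambda>n. e n * x ^ n)" by (rule powser_inside) (use that in auto)
    thus ?thesis unfolding f_def by (rule summable_sums)
  qed
  moreover have f0: "f x = 0" if "0 \<le> x" "x < 1" for x
    using e[OF that] by (simp add: f_def sums_iff)
  ultimately obtain s where s: "0 < s" "\<And>z. z \<in> cball 0 s - {0} \<Longrightarrow> f z \<noteq> 0"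
    using powser_0_nonzero[of 1 0 e f m] m \<open>m > 0\<close> by (auto simp: e_def)
  have "min s (1/2) \<in> cball 0 s - {0}" using s(1) by auto
  from s(2)[OF this] f0[of "min s (1/2)"] s(1) show False by auto
qed

text \<open>
  The sum formula for multiple zeta values: by \<open>sum_run_index\<close> the left hand side is the sum of
  all \<open>\<zeta>(\<alpha>\<^sub>0, \<dots>, \<alpha>\<^sub>a + 1)\<close> with \<open>|\<alpha>| = a + b + 1\<close>.  For \<open>0 \<le> x < 1\<close> the generating functions over \<open>b\<close>
  of both sides are equal to the sum of \<open>1 / (m\<^sup>a\<^sup>+\<^sup>1 (m - x))\<close> over \<open>m > 0\<close>.
\<close>

lemma sum_formula: "(\<lambda>n. int0 (word_sum a b (int1 1)) $ n) sums mzv [a + b + 2]"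
proof -
  define S where "S b = (\<Sum>n. int0 (word_sum a b (int1 1)) $ n :: real)" for b
  have S: "(\<lambda>n. int0 (word_sum a b (int1 1)) $ n) sums S b" for b
    unfolding S_def
    using summable_int0[OF sqrt_decay_word_sum[OF sqrt_decay_int1_1]]
    by (intro summable_sums) (simp only: summable_rabs_cancel)
  have nonneg: "0 \<le> word_sum a b (int1 1 :: real fps) $ n" for b n
    by (rule word_sum_nonneg) (auto intro!: sum_nonneg)
  have "S = (\<lambda>b. mzv [a + b + 2])"
  proof (rule powser_coeffs_unique)
    fix x :: real assume x: "0 \<le> x" "x < 1"
    have mx: "real m - x \<ge> real m * (1 - x)" if "m > 0" for m :: nat
    proof -
      have "x * 1 \<le> x * real m" using that x by (intro mult_left_mono) auto
      thus ?thesis by (simp add: algebra_simps)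
    qed
    have "summable (\<lambda>m. 1 / (real m ^ Suc a * (real m - x)))"
    proof (rule summable_comparison_test')
      show "summable (\<lambda>m. (1 / (1 - x)) * inverse (real m ^ 2))"
        by (intro summable_mult inverse_power_summable) auto
      show "norm (1 / (real m ^ Suc a * (real m - x))) \<le> (1 / (1 - x)) * inverse (real m ^ 2)" for m
      proof (cases "m = 0")
        case False
        hence "real m ^ 1 * (real m * (1 - x)) \<le> real m ^ Suc a * (real m - x)"
          using mx[of m] x by (intro mult_mono power_increasing) auto
        moreover have "0 < real m ^ 1 * (real m * (1 - x))" using False x by simp
        ultimately show ?thesis by (auto simp: field_simps power2_eq_square intro!: divide_left_mono)
      qed simp
    qed
    then obtain R where R: "(\<lambda>m. 1 / (real m ^ Suc a * (real m - x))) sums R" by (auto simp: summable_def)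
    have "(\<lambda>b. S b * x ^ b) sums R"
    proof (rule sums_swap_nonneg[where a = "\<lambda>n b. x ^ b * word_sum a b (int1 1) $ n / real n"])
      show "(\<lambda>b. x ^ b * word_sum a b (int1 1) $ n / real n) sums (perturbed_sum x (Suc a) n / real n)" for n
        by (intro sums_divide word_sum_generating_function x)
      show "(\<lambda>n. perturbed_sum x (Suc a) n / real n) sums R" by (rule perturbed_duality[OF x(2) R])
      show "(\<lambda>n. x ^ b * word_sum a b (int1 1) $ n / real n) sums (S b * x ^ b)" for b
        using sums_mult[OF S, of "x ^ b" b] by (simp add: mult_ac)
      show "0 \<le> x ^ b * word_sum a b (int1 1) $ n / real n" for n b
        using x nonneg by (intro divide_nonneg_nonneg mult_nonneg_nonneg) auto
    qed
    moreover have "(\<lambda>b. mzv [a + b + 2] * x ^ b) sums R"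
    proof (rule sums_swap_nonneg[where a = "\<lambda>m b. x ^ b * (1 / real m ^ (a + b + 2))"])
      show "(\<lambda>b. x ^ b * (1 / real m ^ (a + b + 2))) sums (1 / (real m ^ Suc a * (real m - x)))" for m
      proof (cases "m = 0")
        case False
        hence "(\<lambda>b. (x / real m) ^ b) sums (1 / (1 - x / real m))" using x
          by (intro geometric_sums) (auto simp: field_simps)
        from sums_mult[OF this, of "1 / real m ^ (a + 2)"]
        have "(\<lambda>b. 1 / real m ^ (a + 2) * (x / real m) ^ b) sums (1 / real m ^ (a + 2) * (1 / (1 - x / real m)))" .
        also have "(\<lambda>b. 1 / real m ^ (a + 2) * (x / real m) ^ b) = (\<lambda>b. x ^ b * (1 / real m ^ (a + b + 2)))"
          by (rule ext) (simp add: power_add power_divide)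
        also have "1 / real m ^ (a + 2) * (1 / (1 - x / real m)) = 1 / (real m ^ Suc a * (real m - x))"
        proof -
          have "real m * (1 - x / real m) = real m - x" using False by (simp add: field_simps)
          moreover have "real m ^ (a + 2) * (1 - x / real m) = real m ^ Suc a * (real m * (1 - x / real m))" by simp
          ultimately show ?thesis by simp
        qed
        finally show ?thesis .
      qed simp
      show "(\<lambda>m. x ^ b * (1 / real m ^ (a + b + 2))) sums (mzv [a + b + 2] * x ^ b)" for b
        using sums_mult[OF zeta_sums, of "x ^ b" "a + b"] by (simp add: mult_ac)
    qed (use R x in auto)
    ultimately show "\<exists>s. (\<lambda>b. S b * x ^ b) sums s \<and> (\<lambda>b. mzv [a + b + 2] * x ^ b) sums s" by blast
  qed
  thus ?thesis using S[of b] by simp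
qed

section \<open>The product of two zeta values\<close>

text \<open>
  A substitute for convergence of a series in a real vector space without topology.  It determines the
  value because linear functionals separate points.
\<close>

definition weak_sums :: "(nat \<Rightarrow> 'a::real_vector) \<Rightarrow> 'a \<Rightarrow> bool" where
  "weak_sums F s \<longleftrightarrow> (\<forall>\<phi> :: 'a \<Rightarrow> real. linear \<phi> \<longrightarrow> (\<lambda>n. \<phi> (F n)) sums \<phi> s)"

lemma linear_functional_separates:
  fixes v :: "'a::real_vector"
  assumes "v \<noteq> 0" shows "\<exists>\<phi> :: 'a \<Rightarrow> real. linear \<phi> \<and> \<phi> v \<noteq> 0"
proof -
  have "independent {v}" using assms by simp
  from linear_independent_extend[OF this, of "\<lambda>_. 1 :: real"] show ?thesis by fastforce
qed

lemma weak_sums_unique: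
  assumes "weak_sums F s" "weak_sums F t" shows "s = t"
proof (rule ccontr)
  assume "s \<noteq> t"
  then obtain \<phi> :: "'a \<Rightarrow> real" where \<phi>: "linear \<phi>" "\<phi> (s - t) \<noteq> 0"
    using linear_functional_separates[of "s - t"] by auto
  have "\<phi> s = \<phi> t" using assms \<phi>(1) unfolding weak_sums_def by (metis sums_unique2)
  thus False using \<phi> by (simp add: linear_diff)
qed

lemma weak_sums_add: "weak_sums F s \<Longrightarrow> weak_sums G t \<Longrightarrow> weak_sums (\<lambda>n. F n + G n) (s + t)"
  by (simp add: weak_sums_def linear_add sums_add)

lemma weak_sums_sum:
  assumes "\<And>i. i \<in> A \<Longrightarrow> weak_sums (F i) (s i)"
  shows "weak_sums (\<lambda>n. \<Sum>i\<in>A. F i n) (\<Sum>i\<in>A. s i)"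
  using assms by (auto simp: weak_sums_def linear_sum intro!: sums_sum)

lemma weak_sums_mult_of_real:
  fixes c :: "'a::real_algebra_1"
  assumes "f sums s" shows "weak_sums (\<lambda>n. c * of_real (f n)) (c * of_real s)"
proof -
  have "(\<lambda>n. \<phi> (c * of_real (f n))) sums \<phi> (c * of_real s)" if "linear \<phi>" for \<phi> :: "'a \<Rightarrow> real"
  proof -
    have "\<phi> (c * of_real r) = r * \<phi> c" for r
      using linear_scale[OF that, of r c] by (simp add: of_real_def)
    thus ?thesis using sums_mult2[OF assms, of "\<phi> c"] by simp
  qed
  thus ?thesis by (simp add: weak_sums_def)
qed

definition fps_of_real :: "real fps \<Rightarrow> 'a::real_algebra_1 fps" where
  "fps_of_real f = Abs_fps (\<lambda>n. of_real (f $ n))"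

lemma fps_of_real_nth [simp]: "fps_of_real f $ n = of_real (f $ n)"
  by (simp add: fps_of_real_def)

lemma fps_of_real_add: "fps_of_real (f + g) = fps_of_real f + fps_of_real g"
  and fps_of_real_mult: "fps_of_real (f * g) = fps_of_real f * fps_of_real g"
  and fps_of_real_1: "fps_of_real 1 = 1"
  by (auto intro!: fps_ext simp: fps_mult_nth)

lemma int0_fps_of_real: "int0 (fps_of_real f) = fps_of_real (int0 f)"
  and int1_fps_of_real: "int1 (fps_of_real f) = fps_of_real (int1 f)"
  by (auto intro!: fps_ext simp: scaleR_conv_of_real simp flip: of_real_mult of_real_sum)

lemma word_sum_fps_of_real: "word_sum a b (fps_of_real f) = fps_of_real (word_sum a b f)"
  by (induction a b f rule: word_sum.induct)
     (simp_all add: int0_fps_of_real int1_fps_of_real fps_of_real_add)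

lemmas fps_of_real_operators = int0_fps_of_real int1_fps_of_real word_sum_fps_of_real

text \<open>
  The series to which the flow is applied lives in degree \<open>(0, 0)\<close>, so each degree contains
  exactly one summand.
\<close>

lemma flow_one_nth:
  "flow_one m x $ k $ l = fps_const (m ^ k * x ^ l) * fps_of_real (word_sum k l (int1 1))"
proof -
  have z: "word_sum i j (int1 0) = (0 :: 'a fps)" for i j
    using word_sum_const_mult[of i j "0 :: 'a" 1] int1_const_mult[of "0 :: 'a" 1] by simp
  have "flow_one m x $ k $ l = (\<Sum>i\<le>k. \<Sum>j\<le>l. if i = k then if j = l
           then fps_const (m ^ k * x ^ l) * word_sum k l (int1 1) else 0 else 0)"
    unfolding flow_nth by (intro sum.cong refl) (auto simp: z)
  also have "\<dots> = (\<Sum>i\<le>k. if i = k then \<Sum>j\<le>l. if j = l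
           then fps_const (m ^ k * x ^ l) * word_sum k l (int1 1) else 0 else 0)"
    by (intro sum.cong) auto
  also have "\<dots> = fps_const (m ^ k * x ^ l) * word_sum k l (int1 (fps_of_real 1))"
    by (simp add: fps_of_real_1)
  finally show ?thesis by (simp only: fps_of_real_operators)
qed

lemma sum_pairs:
  fixes f :: "nat \<Rightarrow> nat \<Rightarrow> 'b::comm_monoid_add"
  shows "(\<Sum>(i, j)\<in>{(i, j). i + j = k}. f i j) = (\<Sum>i\<le>k. f i (k - i))"
  by (rule sum.reindex_bij_witness[of _ "\<lambda>i. (i, k - i)" fst]) auto

lemma sum_pairs_snd:
  fixes f :: "nat \<Rightarrow> nat \<Rightarrow> 'b::comm_monoid_add"
  shows "(\<Sum>(i, j)\<in>{(i, j). i + j = k}. f i j) = (\<Sum>j\<le>k. f (k - j) j)"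
  by (rule sum.reindex_bij_witness[of _ "\<lambda>j. (k - j, j)" snd]) auto

lemma sum_triples:
  fixes f :: "nat \<Rightarrow> nat \<Rightarrow> nat \<Rightarrow> 'b::comm_monoid_add"
  shows "(\<Sum>(h, i, j)\<in>{(h, i, j). h + i + j = k}. f h i j) = (\<Sum>j\<le>k. \<Sum>i\<le>k - j. f (k - j - i) i j)"
  unfolding sum.Sigma[OF finite_atMost ballI[OF finite_atMost]]
  by (rule sum.reindex_bij_witness[of _ "\<lambda>(j, i). (k - j - i, i, j)" "\<lambda>(h, i, j). (j, i)"]) auto

definition zeta_block2 :: "nat \<Rightarrow> nat \<Rightarrow> nat \<Rightarrow> nat \<Rightarrow> real" where
  "zeta_block2 a1 b1 a2 b2 =
     (\<Sum>\<alpha>\<in>compositions (a1 + 1) (a1 + b1 + 1). \<Sum>\<beta>\<in>compositions (a2 + 1) (a2 + b2 + 1).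
        mzv (inc_last \<alpha> @ inc_last \<beta>))"

definition zeta_block3 :: "nat \<Rightarrow> nat \<Rightarrow> nat \<Rightarrow> nat \<Rightarrow> nat \<Rightarrow> nat \<Rightarrow> real" where
  "zeta_block3 a1 b1 a2 b2 a3 b3 =
     (\<Sum>\<alpha>\<in>compositions (a1 + 1) (a1 + b1 + 1). \<Sum>\<beta>\<in>compositions (a2 + 1) (a2 + b2 + 1).
      \<Sum>\<gamma>\<in>compositions (a3 + 1) (a3 + b3 + 1). mzv (\<alpha> @ inc_last (merge_lists \<beta> \<gamma>)))"

lemma zeta_block2_sums:
  "(\<lambda>n. int0 (word_sum a2 b2 (int1 (int0 (word_sum a1 b1 (int1 1))))) $ n) sums zeta_block2 a1 b1 a2 b2"
proof -
  have "(\<lambda>n. polylog (inc_last \<alpha> @ inc_last \<beta>) $ n) sums mzv (inc_last \<alpha> @ inc_last \<beta>)"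
    if "\<alpha> \<in> compositions (a1 + 1) (a1 + b1 + 1)" "\<beta> \<in> compositions (a2 + 1) (a2 + b2 + 1)" for \<alpha> \<beta>
  proof -
    note \<alpha> = compositions_admissible[OF that(1)]
     and \<beta> = compositions_admissible[OF that(2)]
    have "\<forall>s\<in>set (inc_last \<alpha> @ \<beta>). 0 < s" using \<alpha> \<beta> by (auto simp: inc_last_def dest: in_set_butlastD)
    thus ?thesis unfolding inc_last_append[OF \<beta>(1)] using \<beta>(1) by (intro polylog_sums_mzv) auto
  qed
  thus ?thesis unfolding sum_polylog_two[symmetric] zeta_block2_def fps_sum_nth
    by (intro sums_sum)
qed

lemma zeta_block3_sums:
  "(\<lambda>n. int0 (word_sum a3 b3 (int0 (word_sum a2 b2 (int1 (word_sum a1 b1 (int1 1)))))) $ n)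
     sums zeta_block3 a1 b1 a2 b2 a3 b3"
proof -
  have "(\<lambda>n. polylog (\<alpha> @ inc_last (merge_lists \<beta> \<gamma>)) $ n) sums mzv (\<alpha> @ inc_last (merge_lists \<beta> \<gamma>))"
    if "\<alpha> \<in> compositions (a1 + 1) (a1 + b1 + 1)" "\<beta> \<in> compositions (a2 + 1) (a2 + b2 + 1)"
       "\<gamma> \<in> compositions (a3 + 1) (a3 + b3 + 1)" for \<alpha> \<beta> \<gamma>
  proof -
    note \<alpha> = compositions_admissible[OF that(1)]
     and \<beta> = compositions_admissible[OF that(2)]
     and \<gamma> = compositions_admissible[OF that(3)]
    note m = merge_lists_admissible[OF \<beta>(1) \<gamma>(1) \<beta>(4) \<gamma>(4)]
    have "\<forall>s\<in>set (\<alpha> @ merge_lists \<beta> \<gamma>). 0 < s" using \<alpha>(4) m(2) by (simp add: ball_Un)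
    thus ?thesis unfolding inc_last_append[OF m(1)] using m(1) by (intro polylog_sums_mzv) auto
  qed
  thus ?thesis unfolding sum_polylog_three[symmetric] zeta_block3_def fps_sum_nth
    by (intro sums_sum)
qed

text \<open>
  The two kinds of pieces of the product domain, as generating series: \<open>block2\<close> for disjoint intervals
  with the first one below the second, \<open>block3\<close> for overlapping ones.  In \<open>block3\<close> the parameters belong to
  the part below the overlap, the overlap, and the part above it.
\<close>

definition block2 :: "'a::{real_algebra_1, comm_ring_1} \<Rightarrow> 'a \<Rightarrow> 'a \<Rightarrow> 'a \<Rightarrow> 'a graded" where
  "block2 m1 x1 m2 x2 =
     graded_map int0 (flow m2 x2 (graded_map int1 (graded_map int0 (flow_one m1 x1))))"

definition block3 :: "'a::{real_algebra_1, comm_ring_1} \<Rightarrow> 'a \<Rightarrow> 'a \<Rightarrow> 'a \<Rightarrow> 'a \<Rightarrow> 'a \<Rightarrow> 'a graded" where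
  "block3 m1 x1 m2 x2 m3 x3 =
     graded_map int0 (flow m3 x3 (graded_map int0 (flow m2 x2 (graded_map int1 (flow_one m1 x1)))))"

lemma graded_map_int0_add: "graded_map int0 (F + G) = graded_map int0 F + graded_map int0 G"
  and graded_map_int1_add: "graded_map int1 (F + G) = graded_map int1 F + graded_map int1 G"
  by (auto intro!: graded_ext simp: int0_add int1_add)

lemma word_sum_add: "word_sum a b (f + g) = word_sum a b f + word_sum a b g"
  using word_sum_sum[of a b "\<lambda>i. if i then f else g" UNIV] by (simp add: UNIV_bool add.commute)

lemma flow_add: "flow m x (F + G) = flow m x F + flow m x G"
  by (rule graded_ext) (simp add: word_sum_add distrib_left sum.distrib)

lemma product_eq_blocks:
  fixes m1 m2 x1 x2 :: "'a::{real_algebra_1, comm_ring_1}"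
  defines "m \<equiv> m1 + m2" and "x \<equiv> x1 + x2"
  shows "graded_map int0 (flow_one m1 x1) * graded_map int0 (flow_one m2 x2) =
      (block2 m1 x1 m2 x2 + (block3 m1 x1 m x m1 x1 + block3 m1 x1 m x m2 x2)) +
      (block2 m2 x2 m1 x1 + (block3 m2 x2 m x m2 x2 + block3 m2 x2 m x m1 x1))"
  unfolding product_flow block2_def block3_def m_def x_def
  by (simp only: graded_map_int0_add graded_map_int1_add flow_add add_ac)

lemma block2_weak_sums:
  "weak_sums (fps_nth (block2 m1 x1 m2 x2 $ k $ l))
     (\<Sum>(a1, a2)\<in>{(a1, a2). a1 + a2 = k}. \<Sum>(b1, b2)\<in>{(b1, b2). b1 + b2 = l}.
        m1 ^ a1 * m2 ^ a2 * x1 ^ b1 * x2 ^ b2 * of_real (zeta_block2 a1 b1 a2 b2))"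
proof -
  have "block2 m1 x1 m2 x2 $ k $ l = (\<Sum>i\<le>k. \<Sum>j\<le>l.
      fps_const (m1 ^ (k - i) * m2 ^ i * x1 ^ (l - j) * x2 ^ j) *
      fps_of_real (int0 (word_sum i j (int1 (int0 (word_sum (k - i) (l - j) (int1 1)))))))"
    unfolding block2_def graded_map_nth flow_nth[of m2] flow_one_nth int0_sum
    by (intro sum.cong refl)
       (simp only: int0_const_mult int1_const_mult word_sum_const_mult fps_of_real_operators
          mult.assoc[symmetric] fps_const_mult, simp only: mult_ac)
  hence "fps_nth (block2 m1 x1 m2 x2 $ k $ l) = (\<lambda>n. \<Sum>i\<le>k. \<Sum>j\<le>l.
      m1 ^ (k - i) * m2 ^ i * x1 ^ (l - j) * x2 ^ j *
      of_real (int0 (word_sum i j (int1 (int0 (word_sum (k - i) (l - j) (int1 1))))) $ n))"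
    by (intro ext) (simp only: fps_sum_nth fps_mult_left_const_nth fps_of_real_nth)
  thus ?thesis unfolding sum_pairs_snd
    by (simp only:) (intro weak_sums_sum weak_sums_mult_of_real zeta_block2_sums)
qed

lemma block3_weak_sums:
  "weak_sums (fps_nth (block3 m1 x1 m2 x2 m3 x3 $ k $ l))
     (\<Sum>(a1, a2, a3)\<in>{(a1, a2, a3). a1 + a2 + a3 = k}. \<Sum>(b1, b2, b3)\<in>{(b1, b2, b3). b1 + b2 + b3 = l}.
        m1 ^ a1 * x1 ^ b1 * m2 ^ a2 * x2 ^ b2 * (m3 ^ a3 * x3 ^ b3) *
        of_real (zeta_block3 a1 b1 a2 b2 a3 b3))"
proof -
  have "block3 m1 x1 m2 x2 m3 x3 $ k $ l = (\<Sum>i\<le>k. \<Sum>j\<le>l. \<Sum>i'\<le>k - i. \<Sum>j'\<le>l - j.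
      fps_const (m1 ^ (k - i - i') * x1 ^ (l - j - j') * m2 ^ i' * x2 ^ j' * (m3 ^ i * x3 ^ j)) *
      fps_of_real (int0 (word_sum i j (int0 (word_sum i' j' (int1 (word_sum (k - i - i') (l - j - j') (int1 1))))))))"
    unfolding block3_def graded_map_nth flow_nth[of m3] flow_nth[of m2] flow_one_nth int0_sum word_sum_sum sum_distrib_left
    by (intro sum.cong refl)
       (simp only: int0_const_mult int1_const_mult word_sum_const_mult fps_of_real_operators
          mult.assoc[symmetric] fps_const_mult, simp only: mult_ac)
  also have "\<dots> = (\<Sum>i\<le>k. \<Sum>i'\<le>k - i. \<Sum>j\<le>l. \<Sum>j'\<le>l - j.
      fps_const (m1 ^ (k - i - i') * x1 ^ (l - j - j') * m2 ^ i' * x2 ^ j' * (m3 ^ i * x3 ^ j)) *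
      fps_of_real (int0 (word_sum i j (int0 (word_sum i' j' (int1 (word_sum (k - i - i') (l - j - j') (int1 1))))))))"
    by (intro sum.cong refl sum.swap)
  finally have "fps_nth (block3 m1 x1 m2 x2 m3 x3 $ k $ l) = (\<lambda>n. \<Sum>i\<le>k. \<Sum>i'\<le>k - i. \<Sum>j\<le>l. \<Sum>j'\<le>l - j.
      m1 ^ (k - i - i') * x1 ^ (l - j - j') * m2 ^ i' * x2 ^ j' * (m3 ^ i * x3 ^ j) *
      of_real (int0 (word_sum i j (int0 (word_sum i' j' (int1 (word_sum (k - i - i') (l - j - j') (int1 1)))))) $ n))"
    by (intro ext) (simp only: fps_sum_nth fps_mult_left_const_nth fps_of_real_nth)
  thus ?thesis unfolding sum_triples
    by (simp only:) (intro weak_sums_sum weak_sums_mult_of_real zeta_block3_sums)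
qed

lemma zeta_product_sums:
  "(\<lambda>n. (int0 (word_sum a1 b1 (int1 1)) * int0 (word_sum a2 b2 (int1 1))) $ n)
     sums (mzv [a1 + b1 + 2] * mzv [a2 + b2 + 2])"
proof -
  let ?f = "\<lambda>a b. int0 (word_sum a b (int1 1)) :: real fps"
  have s: "summable (\<lambda>n. norm (?f a b $ n))" for a b
    unfolding real_norm_def by (intro summable_int0 sqrt_decay_word_sum sqrt_decay_int1_1)
  show ?thesis
    using Cauchy_product_sums[OF s[of a1 b1] s[of a2 b2]]
    unfolding sums_unique[OF sum_formula, symmetric] by (simp only: fps_mult_nth atLeast0AtMost)
qed

lemma product_weak_sums:
  "weak_sums (fps_nth ((graded_map int0 (flow_one m1 x1) * graded_map int0 (flow_one m2 x2)) $ k $ l))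
     (\<Sum>(a1, a2)\<in>{(a1, a2). a1 + a2 = k}. \<Sum>(b1, b2)\<in>{(b1, b2). b1 + b2 = l}.
        m1 ^ a1 * m2 ^ a2 * x1 ^ b1 * x2 ^ b2 * of_real (mzv [a1 + b1 + 2] * mzv [a2 + b2 + 2]))"
proof -
  let ?f = "\<lambda>a b. int0 (word_sum a b (int1 1)) :: real fps"
  have "(graded_map int0 (flow_one m1 x1) * graded_map int0 (flow_one m2 x2)) $ k $ l =
     (\<Sum>i\<le>k. \<Sum>j\<le>l. fps_const (m1 ^ i * m2 ^ (k - i) * x1 ^ j * x2 ^ (l - j)) *
         fps_of_real (?f i j * ?f (k - i) (l - j)))"
    unfolding graded_mult_nth graded_map_nth flow_one_nth atLeast0AtMost
    by (intro sum.cong refl)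
       (simp only: int0_const_mult fps_of_real_operators fps_of_real_mult fps_const_mult[symmetric] mult_ac)
  hence "fps_nth ((graded_map int0 (flow_one m1 x1) * graded_map int0 (flow_one m2 x2)) $ k $ l) =
     (\<lambda>n. \<Sum>i\<le>k. \<Sum>j\<le>l. m1 ^ i * m2 ^ (k - i) * x1 ^ j * x2 ^ (l - j) *
         of_real ((?f i j * ?f (k - i) (l - j)) $ n))"
    by (intro ext) (simp only: fps_sum_nth fps_mult_left_const_nth fps_of_real_nth)
  thus ?thesis unfolding sum_pairs
    by (simp only:) (intro weak_sums_sum weak_sums_mult_of_real zeta_product_sums)
qed

lemma sum_permutations_pair:
  fixes T :: "nat \<Rightarrow> nat \<Rightarrow> 'b::comm_monoid_add"
  shows "(\<Sum>\<sigma>\<in>{\<sigma>. \<sigma> permutes {1, 2}}. T (\<sigma> 1) (\<sigma> 2)) = T 1 2 + T 2 1"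
proof -
  have "{\<sigma>. \<sigma> permutes {1, 2 :: nat}} = {id, Transposition.transpose 1 2}"
    by (auto simp: permutes_doubleton_iff)
  moreover have "id \<noteq> Transposition.transpose 1 (2 :: nat)"
    by (auto simp: fun_eq_iff Transposition.transpose_def)
  ultimately show ?thesis by simp
qed

theorem theorem1p1:
  fixes k l :: nat
    and \<mu> \<xi> :: "nat \<Rightarrow> 'a::{real_algebra_1, comm_ring_1}"
  shows
    "(\<Sum>(a1, a2)\<in>{(a1, a2). a1 + a2 = k}. \<Sum>(b1, b2)\<in>{(b1, b2). b1 + b2 = l}.
        \<mu> 1 ^ a1 * \<mu> 2 ^ a2 * \<xi> 1 ^ b1 * \<xi> 2 ^ b2 *
        of_real (mzv [a1 + b1 + 2] * mzv [a2 + b2 + 2]))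
     = (\<Sum>\<sigma>\<in>{\<sigma>. \<sigma> permutes {1, 2}}.
         (\<Sum>(a1, a2)\<in>{(a1, a2). a1 + a2 = k}. \<Sum>(b1, b2)\<in>{(b1, b2). b1 + b2 = l}.
            \<mu> (\<sigma> 1) ^ a1 * \<mu> (\<sigma> 2) ^ a2 * \<xi> (\<sigma> 1) ^ b1 * \<xi> (\<sigma> 2) ^ b2 *
            of_real (\<Sum>\<alpha>\<in>compositions (a1 + 1) (a1 + b1 + 1).
                     \<Sum>\<beta>\<in>compositions (a2 + 1) (a2 + b2 + 1).
                       mzv (inc_last \<alpha> @ inc_last \<beta>)))
       + (\<Sum>(a1, a2, a3)\<in>{(a1, a2, a3). a1 + a2 + a3 = k}.
          \<Sum>(b1, b2, b3)\<in>{(b1, b2, b3). b1 + b2 + b3 = l}.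
            \<mu> (\<sigma> 1) ^ a1 * \<xi> (\<sigma> 1) ^ b1 *
            (\<mu> (\<sigma> 1) + \<mu> (\<sigma> 2)) ^ a2 * (\<xi> (\<sigma> 1) + \<xi> (\<sigma> 2)) ^ b2 *
            (\<mu> (\<sigma> 1) ^ a3 * \<xi> (\<sigma> 1) ^ b3 + \<mu> (\<sigma> 2) ^ a3 * \<xi> (\<sigma> 2) ^ b3) *
            of_real (\<Sum>\<alpha>\<in>compositions (a1 + 1) (a1 + b1 + 1).
                     \<Sum>\<beta>\<in>compositions (a2 + 1) (a2 + b2 + 1).
                     \<Sum>\<gamma>\<in>compositions (a3 + 1) (a3 + b3 + 1).
                       mzv (\<alpha> @ inc_last (merge_lists \<beta> \<gamma>)))))"
proof -
  define D where "D p q = (\<Sum>(a1, a2)\<in>{(a1, a2). a1 + a2 = k}. \<Sum>(b1, b2)\<in>{(b1, b2). b1 + b2 = l}.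
      \<mu> p ^ a1 * \<mu> q ^ a2 * \<xi> p ^ b1 * \<xi> q ^ b2 * of_real (zeta_block2 a1 b1 a2 b2))" for p q
  define Q where "Q p q r = (\<Sum>(a1, a2, a3)\<in>{(a1, a2, a3). a1 + a2 + a3 = k}.
      \<Sum>(b1, b2, b3)\<in>{(b1, b2, b3). b1 + b2 + b3 = l}.
        \<mu> p ^ a1 * \<xi> p ^ b1 * (\<mu> p + \<mu> q) ^ a2 * (\<xi> p + \<xi> q) ^ b2 *
        (\<mu> r ^ a3 * \<xi> r ^ b3) * of_real (zeta_block3 a1 b1 a2 b2 a3 b3))" for p q r
  let ?H = "\<lambda>p. graded_map int0 (flow_one (\<mu> p) (\<xi> p))"
  have D: "weak_sums (fps_nth (block2 (\<mu> p) (\<xi> p) (\<mu> q) (\<xi> q) $ k $ l)) (D p q)" for p q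
    unfolding D_def by (rule block2_weak_sums)
  have Q: "weak_sums (fps_nth (block3 (\<mu> p) (\<xi> p) (\<mu> p + \<mu> q) (\<xi> p + \<xi> q) (\<mu> r) (\<xi> r) $ k $ l)) (Q p q r)"
    for p q r
    unfolding Q_def by (rule block3_weak_sums)
  \<comment> \<open>The left hand side is a weak sum of the same coefficients, by \<open>product_weak_sums\<close>.\<close>
  have "weak_sums (fps_nth ((?H 1 * ?H 2) $ k $ l))
          ((D 1 2 + (Q 1 2 1 + Q 1 2 2)) + (D 2 1 + (Q 2 1 2 + Q 2 1 1)))"
    unfolding product_eq_blocks fps_add_nth
    by (intro weak_sums_add D Q Q[of 2 1, unfolded add.commute[of "\<mu> 2"] add.commute[of "\<xi> 2"]])
  note * = weak_sums_unique[OF product_weak_sums this]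
  have triple: "(\<Sum>(a1, a2, a3)\<in>{(a1, a2, a3). a1 + a2 + a3 = k}.
      \<Sum>(b1, b2, b3)\<in>{(b1, b2, b3). b1 + b2 + b3 = l}.
        \<mu> p ^ a1 * \<xi> p ^ b1 * (\<mu> p + \<mu> q) ^ a2 * (\<xi> p + \<xi> q) ^ b2 *
        (\<mu> p ^ a3 * \<xi> p ^ b3 + \<mu> q ^ a3 * \<xi> q ^ b3) * of_real (zeta_block3 a1 b1 a2 b2 a3 b3)) =
      Q p q p + Q p q q" for p q
    unfolding Q_def sum_triples by (simp only: distrib_left distrib_right sum.distrib)
  show ?thesis
    unfolding zeta_block2_def[symmetric] zeta_block3_def[symmetric] triple
    unfolding D_def[symmetric] sum_permutations_pair[of "\<lambda>p q. D p q + (Q p q p + Q p q q)"] *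
    by (rule refl)
qed

end
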